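(* For every integer $t\ge2$ there exists $\varepsilon_0>0$ such that for every $0<\varepsilon\le\varepsilon_0$ there exists $n_0$ such that for all $n\ge n_0$: any red-blue $K_n$ containing more than $(1-\varepsilon)\frac{n}{4t}\left(\frac{n-1}{2}\right)^{4t-1}$ alternating $4t$-cycles is $\delta$-bipartite, where $\delta=(4\varepsilon)^{1/32}$.
   Context: A red-blue $K_n$ is a complete graph on vertex set $V$, $|V|=n$, each edge coloured red or blue; $R$ and $B$ denote the graphs of red and blue edges. An alternating $4t$-cycle is a cycle with $4t$ edges (a subgraph) whose colours alternate red and blue around the cycle. For $0\le\delta\le1$, $G$ is $\delta$-bipartite if there is a partition $V=X\cup Y$ with (B1) $\lfloor n/2\rfloor-\delta n\le|X|,|Y|\le\lceil n/2\rceil+\delta n$, and (B2) either $|E(R)\triangle E(K_{X,Y})|\le\delta\binom n2$ or $|E(B)\triangle E(K_{X,Y})|\le\delta\binom n2$, where $K_{X,Y}$ is the complete bipartite graph with parts $X,Y$ and $\triangle$ is symmetric difference. *)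

theory Defs
  imports Complex_Main "HOL-Library.Ramsey"
begin

text \<open>Edges are two-element sets of vertices; a graph on a fixed vertex set is given by its edge set.
  \<^term>\<open>R\<close> and \<^term>\<open>B\<close> are the edge sets of the red and the blue graph.\<close>

definition red_blue_complete :: "'a set \<Rightarrow> 'a set set \<Rightarrow> 'a set set \<Rightarrow> bool" where
  "red_blue_complete V R B \<longleftrightarrow> finite V \<and> R \<union> B = nsets V 2 \<and> R \<inter> B = {}"

definition cycle_edge :: "'a list \<Rightarrow> nat \<Rightarrow> 'a set" where
  "cycle_edge vs i = {vs ! (i mod length vs), vs ! (Suc i mod length vs)}"

text \<open>A cycle is counted as a subgraph, so it is represented by its edge set: the \<open>2k\<close> vertex
  sequences that trace out the same \<open>k\<close>-cycle (rotations and reflections) give one and the same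
  element.\<close>

definition alternating_cycles :: "'a set \<Rightarrow> 'a set set \<Rightarrow> 'a set set \<Rightarrow> nat \<Rightarrow> 'a set set set" where
  "alternating_cycles V R B k =
     {cycle_edge vs ` {..<k} | vs.
        k \<ge> 3 \<and> length vs = k \<and> distinct vs \<and> set vs \<subseteq> V \<and>
        (\<forall>i<k. (cycle_edge vs i \<in> R \<and> cycle_edge vs (Suc i) \<in> B) \<or>
               (cycle_edge vs i \<in> B \<and> cycle_edge vs (Suc i) \<in> R))}"

definition complete_bipartite_edges :: "'a set \<Rightarrow> 'a set \<Rightarrow> 'a set set" where
  "complete_bipartite_edges X Y = {{x, y} | x y. x \<in> X \<and> y \<in> Y}"

definition delta_bipartite :: "real \<Rightarrow> 'a set \<Rightarrow> 'a set set \<Rightarrow> 'a set set \<Rightarrow> bool" where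
  "delta_bipartite \<delta> V R B \<longleftrightarrow>
     (\<exists>X Y. X \<union> Y = V \<and> X \<inter> Y = {} \<and>
        (\<forall>Z \<in> {X, Y}.
           of_int \<lfloor>real (card V) / 2\<rfloor> - \<delta> * real (card V) \<le> real (card Z) \<and>
           real (card Z) \<le> of_int \<lceil>real (card V) / 2\<rceil> + \<delta> * real (card V)) \<and>
        (real (card (sym_diff R (complete_bipartite_edges X Y))) \<le> \<delta> * real (card V choose 2) \<or>
         real (card (sym_diff B (complete_bipartite_edges X Y))) \<le> \<delta> * real (card V choose 2)))"

end

theory Submission
  imports Defs
begin

text \<open>
  Let \<open>R\<close> and \<open>B\<close> also denote the adjacency matrices. Each alternating \<open>4t\<close>-cycle gives \<open>4t\<close> closed
  walks counted by the trace of \<open>(RB)\<^sup>2\<^sup>t\<close>. By Cauchy-Schwarz, \<open>B\<close> maps the \<open>\<ell>\<^sup>2\<close>-norm weighted by the blue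
  degrees into the one weighted by the red degrees with operator norm at most \<open>(n - 1) / 2\<close>, because
  the red degree times the blue degree of a vertex is at most \<open>((n - 1) / 2)\<^sup>2\<close>; likewise with the colours exchanged.
  This bounds the trace, and near-extremality forces both that almost all vertices have balanced
  degrees and that the sum of all squared entries of \<open>RB\<close>, which is the sum over pairs of vertices of
  red codegree times blue codegree, is almost \<open>n\<^sup>4 / 8\<close>.

  With the sign matrix \<open>S = R - B\<close>, that product of codegrees at \<open>(u, v)\<close> is at most
  \<open>(n + c)\<^sup>2 / 16\<close> where \<open>c = (S\<^sup>2)(u, v)\<close>, so the sum of all \<open>c\<^sup>2\<close>, which is the trace of \<open>S\<^sup>4\<close>, is almost \<open>n\<^sup>4\<close>.
  Fixing two vertices \<open>v\<close>, \<open>w\<close> that are at least average in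
  \<open>\<Sum> S(u, z) S(u, w) S(v, z) S(v, w)\<close> shows that \<open>S(u, z)\<close> almost equals a product \<open>g(u) f(z)\<close> of signs,
  and symmetry of \<open>S\<close> forces \<open>g\<close> to be almost \<open>f\<close> or almost \<open>-f\<close>. The two level sets of \<open>f\<close> are the parts.
\<close>

section \<open>Cauchy-Schwarz and contraction in weighted norms\<close>

lemma weighted_Cauchy_Schwarz:
  fixes a v :: "'a \<Rightarrow> real"
  assumes "\<And>x. x \<in> A \<Longrightarrow> 0 \<le> a x"
  shows "(\<Sum>x\<in>A. a x * v x)\<^sup>2 \<le> (\<Sum>x\<in>A. a x) * (\<Sum>x\<in>A. a x * (v x)\<^sup>2)"
proof -
  have "2 * (\<Sum>x\<in>A. a x * v x)\<^sup>2 = (\<Sum>x\<in>A. \<Sum>y\<in>A. a x * a y * (2 * v x * v y))"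
    by (simp add: power2_eq_square sum_product sum_distrib_left mult_ac)
  also have "\<dots> \<le> (\<Sum>x\<in>A. \<Sum>y\<in>A. a x * a y * ((v x)\<^sup>2 + (v y)\<^sup>2))"
    by (intro sum_mono mult_left_mono sum_squares_bound mult_nonneg_nonneg assms)
  also have "\<dots> = (\<Sum>x\<in>A. \<Sum>y\<in>A. a y * (a x * (v x)\<^sup>2)) + (\<Sum>x\<in>A. \<Sum>y\<in>A. a x * (a y * (v y)\<^sup>2))"
    by (simp add: algebra_simps sum.distrib)
  also have "\<dots> = 2 * ((\<Sum>x\<in>A. a x) * (\<Sum>x\<in>A. a x * (v x)\<^sup>2))"
    by (subst (1) sum.swap) (simp add: sum_product)
  finally show ?thesis by simp
qed

text \<open>This is a Schur test: Cauchy-Schwarz in each row with the row itself as weight, then an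
  exchange of the sums, where symmetry turns column sums into row sums. The weights differ on the
  two sides so that a red and a blue step can be chained.\<close>

lemma weighted_norm_contraction:
  fixes a :: "'a \<Rightarrow> 'a \<Rightarrow> real" and v w :: "'a \<Rightarrow> real"
  assumes nn: "\<And>x y. 0 \<le> a x y" and sym: "\<And>x y. a x y = a y x"
    and w: "\<And>x. x \<in> A \<Longrightarrow> 0 \<le> w x"
    and q: "\<And>x. x \<in> A \<Longrightarrow> w x * (\<Sum>y\<in>A. a x y) \<le> q"
  shows "(\<Sum>x\<in>A. w x * (\<Sum>y\<in>A. a x y * v y)\<^sup>2) \<le> q * (\<Sum>y\<in>A. (\<Sum>x\<in>A. a y x) * (v y)\<^sup>2)"
proof -
  have "(\<Sum>x\<in>A. w x * (\<Sum>y\<in>A. a x y * v y)\<^sup>2)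
      \<le> (\<Sum>x\<in>A. w x * ((\<Sum>y\<in>A. a x y) * (\<Sum>y\<in>A. a x y * (v y)\<^sup>2)))"
    by (intro sum_mono mult_left_mono weighted_Cauchy_Schwarz nn w)
  also have "\<dots> = (\<Sum>x\<in>A. (w x * (\<Sum>y\<in>A. a x y)) * (\<Sum>y\<in>A. a x y * (v y)\<^sup>2))"
    by (simp add: mult_ac)
  also have "\<dots> \<le> (\<Sum>x\<in>A. q * (\<Sum>y\<in>A. a x y * (v y)\<^sup>2))"
    by (intro sum_mono mult_right_mono q sum_nonneg mult_nonneg_nonneg nn) auto
  also have "\<dots> = q * (\<Sum>y\<in>A. \<Sum>x\<in>A. a x y * (v y)\<^sup>2)"
    unfolding sum_distrib_left[symmetric] by (subst sum.swap) simp
  also have "\<dots> = q * (\<Sum>y\<in>A. (\<Sum>x\<in>A. a y x) * (v y)\<^sup>2)"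
    using sym by (intro arg_cong2[of _ _ _ _ "(*)"] sum.cong refl) (simp add: sum_distrib_right)
  finally show ?thesis .
qed

section \<open>Tracings of alternating cycles\<close>

lemma cycle_edge_mod: "cycle_edge vs (i mod length vs) = cycle_edge vs i"
  by (simp add: cycle_edge_def mod_Suc_eq)

lemma cycle_edge_image: "vs \<noteq> [] \<Longrightarrow> cycle_edge vs ` {..<length vs} = range (cycle_edge vs)"
proof -
  assume "vs \<noteq> []"
  then have "cycle_edge vs i \<in> cycle_edge vs ` {..<length vs}" for i
    using cycle_edge_mod[of vs i] by (metis imageI length_greater_0_conv lessThan_iff mod_less_divisor)
  then show ?thesis by auto
qed

lemma cycle_edge_rotate: "vs \<noteq> [] \<Longrightarrow> cycle_edge (rotate j vs) i = cycle_edge vs (j + i)"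
  by (simp add: cycle_edge_def nth_rotate mod_add_right_eq flip: add_Suc_right)

lemma cycle_edge_add_mult: "cycle_edge vs (i + length vs * j) = cycle_edge vs i"
  by (metis cycle_edge_mod mod_mult_self2)

lemma range_cycle_edge_rotate:
  assumes "vs \<noteq> []"
  shows "range (cycle_edge (rotate j vs)) = range (cycle_edge vs)"
proof
  show "range (cycle_edge (rotate j vs)) \<subseteq> range (cycle_edge vs)"
    using assms by (auto simp: cycle_edge_rotate)
  have "cycle_edge vs i = cycle_edge (rotate j vs) (i + (length vs - 1) * j)" for i
  proof -
    have "j + (i + (length vs - 1) * j) = i + length vs * j"
      using assms by (cases "length vs") auto
    then show ?thesis using assms by (metis cycle_edge_rotate cycle_edge_add_mult)
  qed
  then show "range (cycle_edge vs) \<subseteq> range (cycle_edge (rotate j vs))" by auto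
qed

text \<open>Reversal reflects edge indices about the cycle. The reflected index
  \<open>k - 2 - i\<close> is shifted by one full period \<open>k\<close>, since at
  \<open>i = k - 1\<close> natural subtraction would truncate it.\<close>

lemma cycle_edge_rev:
  assumes "length vs \<ge> 2"
  shows "cycle_edge (rev vs) i = cycle_edge vs (2 * length vs - 2 - i mod length vs)"
proof -
  define k where "k = length vs"
  define m where "m = i mod k"
  have k: "k \<ge> 2" and m: "m < k" using assms by (auto simp: k_def m_def intro!: mod_less_divisor)
  have e: "cycle_edge (rev vs) i = cycle_edge (rev vs) m"
    using cycle_edge_mod[of "rev vs" i] by (simp add: m_def k_def)
  show ?thesis
  proof (cases "Suc m < k")
    case True
    have "2 * k - 2 - m = (k - 2 - m) + k" using True by simp
    then have "cycle_edge vs (2 * k - 2 - m) = cycle_edge vs (k - 2 - m)"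
      using cycle_edge_add_mult[of vs "k - 2 - m" 1] by (simp add: k_def)
    moreover have "Suc (k - 2 - m) = k - 1 - m" using True by simp
    ultimately show ?thesis
      unfolding e using True by (simp add: cycle_edge_def rev_nth m_def[symmetric] k_def[symmetric] insert_commute)
  next
    case False
    then have "Suc m = k" using m by simp
    then have [simp]: "m = k - 1" "Suc m mod k = 0" "2 * k - 2 - m = k - 1" "Suc (k - Suc 0) = k" using k by auto
    show ?thesis
      unfolding e using k
      by (simp add: cycle_edge_def rev_nth m_def[symmetric] k_def[symmetric] insert_commute)
  qed
qed

lemma range_cycle_edge_rev:
  assumes "length vs \<ge> 2"
  shows "range (cycle_edge (rev vs)) = range (cycle_edge vs)"
proof -
  have "range (cycle_edge (rev ws)) \<subseteq> range (cycle_edge ws)" if "length ws \<ge> 2" for ws :: "'a list"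
    using that by (auto simp: cycle_edge_rev)
  from this[of vs] this[of "rev vs"] assms show ?thesis by auto
qed

text \<open>A red first edge makes the colour of an edge depend only on the parity of its index.
  Indices are unbounded so that rotations need no wrap-around; for even \<open>k\<close> this agrees
  with the condition on the first \<open>k\<close> edges, as edges repeat with period
  \<open>k\<close>.\<close>

definition red_start_cycles :: "'a set \<Rightarrow> 'a set set \<Rightarrow> 'a set set \<Rightarrow> nat \<Rightarrow> 'a list set" where
  "red_start_cycles V R B k = {vs. length vs = k \<and> distinct vs \<and> set vs \<subseteq> V \<and>
     (\<forall>i. cycle_edge vs i \<in> (if even i then R else B))}"

lemma rotate_red_start_cycles:
  assumes "vs \<in> red_start_cycles V R B k" "even j" "k > 0"
  shows "rotate j vs \<in> red_start_cycles V R B k"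
proof -
  have "cycle_edge (rotate j vs) i \<in> (if even i then R else B)" for i
  proof -
    have "cycle_edge vs (j + i) \<in> (if even (j + i) then R else B)"
      using assms(1) unfolding red_start_cycles_def by blast
    moreover have "vs \<noteq> []" using assms by (auto simp: red_start_cycles_def)
    ultimately show ?thesis using assms(2) by (simp add: cycle_edge_rotate)
  qed
  then show ?thesis using assms by (simp add: red_start_cycles_def)
qed

lemma rev_red_start_cycles:
  assumes "vs \<in> red_start_cycles V R B k" "even k" "k \<ge> 2"
  shows "rev vs \<in> red_start_cycles V R B k"
proof -
  have "even (2 * k - 2 - i mod k) = even i" for i
  proof -
    have "i mod k < k" using assms(3) by simp
    moreover have "even (i mod k) = even i" using assms(2) by (simp add: dvd_mod_iff)
    moreover have "2 * k - 2 - i mod k + i mod k = 2 * (k - 1)" using calculation(1) assms(3) by linarith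
    ultimately show ?thesis by (metis dvd_triv_left even_add)
  qed
  then have "cycle_edge (rev vs) i \<in> (if even i then R else B)" for i
    using assms cycle_edge_rev[of vs i] unfolding red_start_cycles_def by (metis (mono_tags, lifting) mem_Collect_eq)
  then show ?thesis
    using assms by (simp add: red_start_cycles_def)
qed

text \<open>As the colours are disjoint, the colour of one edge determines that of the next, by
  induction all around the cycle. A tracing with a blue first edge is rotated by one place.\<close>

lemma alternating_cycle_red_start:
  assumes disj: "R \<inter> B = {}" and C: "C \<in> alternating_cycles V R B k" and k: "even k"
  obtains vs where "vs \<in> red_start_cycles V R B k" "range (cycle_edge vs) = C"
proof -
  obtain vs where vs: "C = cycle_edge vs ` {..<k}" "k \<ge> 3" "length vs = k" "distinct vs" "set vs \<subseteq> V"
    and alt: "\<And>i. i < k \<Longrightarrow> (cycle_edge vs i \<in> R \<and> cycle_edge vs (Suc i) \<in> B) \<or>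
               (cycle_edge vs i \<in> B \<and> cycle_edge vs (Suc i) \<in> R)"
    using C unfolding alternating_cycles_def by blast
  have ne: "vs \<noteq> []" using vs by auto
  have rng: "range (cycle_edge vs) = C" using cycle_edge_image[OF ne] vs by simp
  have alt': "(cycle_edge vs i \<in> R \<and> cycle_edge vs (Suc i) \<in> B) \<or>
               (cycle_edge vs i \<in> B \<and> cycle_edge vs (Suc i) \<in> R)" for i
  proof -
    have "cycle_edge vs (Suc (i mod k)) = cycle_edge vs (Suc i)"
      by (metis cycle_edge_mod mod_Suc_eq vs(3))
    moreover have "i mod k < k" using vs(2) by simp
    ultimately show ?thesis using alt[of "i mod k"] cycle_edge_mod[of vs i] vs(3) by simp
  qed
  show ?thesis
  proof (cases "cycle_edge vs 0 \<in> R")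
    case True
    have "cycle_edge vs i \<in> (if even i then R else B)" for i
    proof (induction i)
      case (Suc i)
      then show ?case using alt'[of i] disj by (auto split: if_splits)
    qed (use True in simp)
    then have "vs \<in> red_start_cycles V R B k" using vs by (simp add: red_start_cycles_def)
    then show ?thesis using that rng by blast
  next
    case False
    then have "cycle_edge vs (Suc 0) \<in> R" using alt'[of 0] by auto
    have "cycle_edge vs (1 + i) \<in> (if even i then R else B)" for i
    proof (induction i)
      case (Suc i)
      then show ?case using alt'[of "1 + i"] disj by (auto split: if_splits)
    qed (use \<open>cycle_edge vs (Suc 0) \<in> R\<close> in simp)
    then have "rotate 1 vs \<in> red_start_cycles V R B k"
      using vs cycle_edge_rotate[OF ne, of 1] by (simp add: red_start_cycles_def)
    then show ?thesis using that rng range_cycle_edge_rotate[OF ne] by blast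
  qed
qed

lemma finite_red_start_cycles: "finite V \<Longrightarrow> finite (red_start_cycles V R B k)"
  by (rule finite_subset[OF _ finite_lists_length_eq[of V k]]) (auto simp: red_start_cycles_def)

text \<open>Every vertex of an alternating cycle is the head of a tracing that starts with a red edge: the
  rotations of a tracing reach every other vertex, and those of its reversal the remaining ones.\<close>

lemma card_red_start_tracings:
  assumes fin: "finite V" and vs: "vs \<in> red_start_cycles V R B k" and k: "even k" "k \<ge> 2"
  shows "k \<le> card {ws \<in> red_start_cycles V R B k. range (cycle_edge ws) = range (cycle_edge vs)}"
proof -
  define tr where "tr i = (if even i then rotate i vs else rotate (k - 1 - i) (rev vs))" for i
  have len: "length vs = k" "distinct vs" using vs by (auto simp: red_start_cycles_def)
  have ne: "vs \<noteq> []" using len k by auto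
  have hd: "tr i ! 0 = vs ! i" if "i < k" for i
    using that len k by (auto simp: tr_def nth_rotate rev_nth)
  have "tr i \<in> red_start_cycles V R B k" if "i < k" for i
    using that k vs rotate_red_start_cycles[OF vs]
      rotate_red_start_cycles[OF rev_red_start_cycles[OF vs k], of "k - 1 - i"]
    by (auto simp: tr_def)
  moreover have "range (cycle_edge (tr i)) = range (cycle_edge vs)" for i
    using ne k len by (simp add: tr_def range_cycle_edge_rotate range_cycle_edge_rev)
  ultimately have sub: "tr ` {..<k} \<subseteq> {ws \<in> red_start_cycles V R B k. range (cycle_edge ws) = range (cycle_edge vs)}"
    by blast
  have "inj_on tr {..<k}"
  proof (rule inj_onI)
    fix i j assume ij: "i \<in> {..<k}" "j \<in> {..<k}" and "tr i = tr j"
    then have "vs ! i = vs ! j" by (metis hd lessThan_iff)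
    then show "i = j" using ij len by (simp add: nth_eq_iff_index_eq)
  qed
  then have "k = card (tr ` {..<k})" by (simp add: card_image)
  also have "\<dots> \<le> card {ws \<in> red_start_cycles V R B k. range (cycle_edge ws) = range (cycle_edge vs)}"
    by (intro card_mono sub) (simp add: finite_red_start_cycles[OF fin])
  finally show ?thesis .
qed

text \<open>The tracings are grouped by the cycle that they trace, and each group has at least
  \<open>k\<close> members. The factor is \<open>k\<close> rather than \<open>2k\<close> because
  half of the rotations and reflections start with a blue edge.\<close>

lemma card_alternating_cycles_le:
  assumes fin: "finite V" and disj: "R \<inter> B = {}" and k: "even k" "k \<ge> 2"
  shows "k * card (alternating_cycles V R B k) \<le> card (red_start_cycles V R B k)"
proof -
  let ?S = "red_start_cycles V R B k" and ?C = "alternating_cycles V R B k"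
  let ?fib = "\<lambda>C. {ws \<in> ?S. range (cycle_edge ws) = C}"
  have finS: "finite ?S" by (rule finite_red_start_cycles[OF fin])
  have "?C \<subseteq> (\<lambda>vs. range (cycle_edge vs)) ` ?S"
    using alternating_cycle_red_start[OF disj _ k(1)] by blast
  then have finC: "finite ?C" using finS finite_surj by blast
  have "k * card ?C = (\<Sum>C\<in>?C. k)" by simp
  also have "\<dots> \<le> (\<Sum>C\<in>?C. card (?fib C))"
  proof (rule sum_mono)
    fix C assume "C \<in> ?C"
    then obtain vs where "vs \<in> ?S" "range (cycle_edge vs) = C"
      by (rule alternating_cycle_red_start[OF disj _ k(1)])
    then show "k \<le> card (?fib C)" using card_red_start_tracings[OF fin _ k] by blast
  qed
  also have "\<dots> = card (\<Union>C\<in>?C. ?fib C)"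
    using finC finS by (intro card_UN_disjoint[symmetric]) auto
  also have "\<dots> \<le> card ?S" by (intro card_mono finS) auto
  finally show ?thesis .
qed

section \<open>Alternating walks as vertex lists\<close>

text \<open>The starting vertex is kept outside the list, so a closed walk with \<open>2m\<close>
  edges is a list of length \<open>2m\<close> that ends in its start. Each recursion consumes one
  red and one blue edge, matching one factor of the matrix product RB.\<close>

fun alt_walk :: "'a set set \<Rightarrow> 'a set set \<Rightarrow> 'a \<Rightarrow> 'a list \<Rightarrow> 'a \<Rightarrow> bool" where
  "alt_walk R B x [] y \<longleftrightarrow> x = y"
| "alt_walk R B x [u] y \<longleftrightarrow> False"
| "alt_walk R B x (u # v # ws) y \<longleftrightarrow> {x, u} \<in> R \<and> {u, v} \<in> B \<and> alt_walk R B v ws y"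

lemma alt_walkI:
  assumes "length ws = 2 * m" "(x # ws) ! (2 * m) = y"
    "\<And>i. i < 2 * m \<Longrightarrow> {(x # ws) ! i, ws ! i} \<in> (if even i then R else B)"
  shows "alt_walk R B x ws y"
  using assms
proof (induction m arbitrary: x ws)
  case (Suc m)
  then obtain u v us where ws: "ws = u # v # us" "length us = 2 * m"
    by (auto simp: length_Suc_conv)
  have "alt_walk R B v us y"
  proof (rule Suc.IH)
    show "{(v # us) ! i, us ! i} \<in> (if even i then R else B)" if "i < 2 * m" for i
      using Suc.prems(3)[of "Suc (Suc i)"] that by (simp add: ws)
  qed (use Suc.prems ws in auto)
  then show ?case using Suc.prems(3)[of 0] Suc.prems(3)[of 1] by (simp add: ws)
qed simp

definition alt_walks :: "'a set \<Rightarrow> 'a set set \<Rightarrow> 'a set set \<Rightarrow> nat \<Rightarrow> 'a \<Rightarrow> 'a \<Rightarrow> 'a list set" where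
  "alt_walks V R B m x y = {ws. set ws \<subseteq> V \<and> length ws = 2 * m \<and> alt_walk R B x ws y}"

lemma finite_alt_walks: "finite V \<Longrightarrow> finite (alt_walks V R B m x y)"
  by (rule finite_subset[OF _ finite_lists_length_eq[of V "2 * m"]]) (auto simp: alt_walks_def)

text \<open>\<open>rotate1\<close> moves the head to the end and so closes the tracing into a walk
  from the head to itself. It is injective, and forgetting that the vertices are distinct only adds
  further walks.\<close>

lemma card_red_start_cycles_le:
  assumes fin: "finite V" and m: "m > 0"
  shows "card (red_start_cycles V R B (2 * m)) \<le> (\<Sum>x\<in>V. card (alt_walks V R B m x x))"
proof -
  have "alt_walk R B (hd vs) (rotate1 vs) (hd vs)" if "vs \<in> red_start_cycles V R B (2 * m)" for vs
  proof (rule alt_walkI)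
    have vs: "length vs = 2 * m" "\<And>i. cycle_edge vs i \<in> (if even i then R else B)"
      using that by (auto simp: red_start_cycles_def)
    have ne: "vs \<noteq> []" using vs m by auto
    have nth: "(hd vs # rotate1 vs) ! i = vs ! (i mod (2 * m))" if "i \<le> 2 * m" for i
      using that vs ne by (cases i) (auto simp: hd_conv_nth nth_rotate1)
    show "length (rotate1 vs) = 2 * m" using vs by simp
    show "(hd vs # rotate1 vs) ! (2 * m) = hd vs" using nth[of "2 * m"] ne by (simp add: hd_conv_nth)
    fix i assume i: "i < 2 * m"
    have "{(hd vs # rotate1 vs) ! i, rotate1 vs ! i} = cycle_edge vs i"
      using nth[of i] nth[of "Suc i"] i vs(1) by (simp add: cycle_edge_def)
    then show "{(hd vs # rotate1 vs) ! i, rotate1 vs ! i} \<in> (if even i then R else B)" using vs(2) by simp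
  qed
  moreover have "hd vs \<in> V \<and> set (rotate1 vs) \<subseteq> V \<and> length (rotate1 vs) = 2 * m"
    if "vs \<in> red_start_cycles V R B (2 * m)" for vs
    using that m by (cases vs) (auto simp: red_start_cycles_def)
  ultimately have "(\<lambda>vs. (hd vs, rotate1 vs)) ` red_start_cycles V R B (2 * m)
      \<subseteq> (SIGMA x:V. alt_walks V R B m x x)"
    unfolding alt_walks_def by blast
  moreover have "inj_on (\<lambda>vs. (hd vs, rotate1 vs)) (red_start_cycles V R B (2 * m))"
    by (rule inj_onI) (simp add: inj_eq[OF inj_rotate1])
  ultimately have "card (red_start_cycles V R B (2 * m)) \<le> card (SIGMA x:V. alt_walks V R B m x x)"
    by (meson card_inj_on_le fin finite_SigmaI finite_alt_walks)
  then show ?thesis using fin by (simp add: finite_alt_walks)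
qed

section \<open>Symmetric matrices close to a product of signs\<close>

lemma sum_bilinear_sharpen_sign:
  fixes s :: "'a \<Rightarrow> 'b \<Rightarrow> real"
  assumes g: "\<And>x. \<bar>g x\<bar> \<le> 1"
  obtains g' where "\<And>x. g' x = 1 \<or> g' x = -1"
    "(\<Sum>x\<in>A. \<Sum>y\<in>C. s x y * (g x * f y)) \<le> (\<Sum>x\<in>A. \<Sum>y\<in>C. s x y * (g' x * f y))"
proof -
  define c where "c x = (\<Sum>y\<in>C. s x y * f y)" for x
  define g' where "g' x = (if c x \<ge> 0 then 1 else -1 :: real)" for x
  have eq: "(\<Sum>y\<in>C. s x y * (h x * f y)) = h x * c x" for x and h :: "'a \<Rightarrow> real"
    by (simp add: c_def sum_distrib_left mult_ac)
  have "g x * c x \<le> g' x * c x" for x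
  proof -
    have "g x * c x \<le> \<bar>g x\<bar> * \<bar>c x\<bar>" by (metis abs_ge_self abs_mult)
    also have "\<dots> \<le> 1 * \<bar>c x\<bar>" by (intro mult_right_mono g) simp
    also have "\<dots> = g' x * c x" by (simp add: g'_def)
    finally show ?thesis .
  qed
  then have "(\<Sum>x\<in>A. \<Sum>y\<in>C. s x y * (g x * f y)) \<le> (\<Sum>x\<in>A. \<Sum>y\<in>C. s x y * (g' x * f y))"
    unfolding eq by (rule sum_mono)
  then show ?thesis by (rule that[rotated]) (simp add: g'_def)
qed

lemma symmetric_sign_factorisation:
  fixes s :: "'a \<Rightarrow> 'a \<Rightarrow> real"
  assumes fin: "finite A" and ne: "A \<noteq> {}" and sym: "\<And>x y. s x y = s y x" and s: "\<And>x y. \<bar>s x y\<bar> \<le> 1"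
    and \<gamma>: "0 \<le> \<gamma>" "\<gamma> \<le> 1 / 2"
    and sum: "(1 - \<gamma>) * real (card A) ^ 4 \<le> (\<Sum>u\<in>A. \<Sum>v\<in>A. (\<Sum>z\<in>A. s u z * s v z)\<^sup>2)"
  obtains f \<tau> where "\<And>x. f x = 1 \<or> f x = -1" "\<tau> = 1 \<or> \<tau> = (-1::real)"
    "(1 - 3 * \<gamma>) * (real (card A))\<^sup>2 \<le> \<tau> * (\<Sum>x\<in>A. \<Sum>y\<in>A. s x y * (f x * f y))"
proof -
  define n where "n = real (card A)"
  have n: "n > 0" using fin ne by (simp add: n_def card_gt_0_iff)
  define K where "K = (\<lambda>v w. \<Sum>u\<in>A. \<Sum>z\<in>A. s u z * (s u w * (s v z * s v w)))"
  have "(\<Sum>u\<in>A. \<Sum>v\<in>A. (\<Sum>z\<in>A. s u z * s v z)\<^sup>2)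
      = (\<Sum>v\<in>A. \<Sum>u\<in>A. \<Sum>w\<in>A. \<Sum>z\<in>A. s u z * (s u w * (s v z * s v w)))"
    unfolding power2_eq_square sum_product by (subst sum.swap) (simp add: mult_ac)
  also have "\<dots> = (\<Sum>v\<in>A. \<Sum>w\<in>A. K v w)"
    unfolding K_def by (intro sum.cong refl sum.swap)
  finally have sumK: "(1 - \<gamma>) * n ^ 4 \<le> (\<Sum>(v, w)\<in>A \<times> A. K v w)"
    using sum by (simp add: n_def sum.cartesian_product)
  \<comment> \<open>Averaging over the n^2 pairs: some pair attains at least the mean of
    \<open>K\<close>.\<close>
  have "\<exists>v w. (1 - \<gamma>) * n\<^sup>2 \<le> K v w"
  proof (rule ccontr)
    assume "\<not> ?thesis"
    then have "(\<Sum>(v, w)\<in>A \<times> A. K v w) < of_nat (card (A \<times> A)) * ((1 - \<gamma>) * n\<^sup>2)"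
      using fin ne by (intro sum_bounded_above_strict) (auto simp: not_le card_gt_0_iff)
    also have "\<dots> = (1 - \<gamma>) * n ^ 4"
      by (simp add: card_cartesian_product n_def power_eq_if)
    finally show False using sumK by simp
  qed
  then obtain v w where vw: "(1 - \<gamma>) * n\<^sup>2 \<le> K v w" by blast
  \<comment> \<open>For fixed \<open>v\<close> and \<open>w\<close>, \<open>K v w\<close> is the
    bilinear form of \<open>s\<close> at two vectors with entries in [-1, 1]. They are rounded to
    signs one after the other, the second through the transpose, without decreasing the
    form.\<close>
  obtain g where g: "\<And>x. g x = 1 \<or> g x = (-1::real)"
    and Kg: "K v w \<le> (\<Sum>x\<in>A. \<Sum>y\<in>A. s x y * (g x * (s v y * s v w)))"
    unfolding K_def
    by (rule sum_bilinear_sharpen_sign[of "\<lambda>x. s x w" s "\<lambda>y. s v y * s v w" A A, OF s]) blast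
  have "\<bar>s v y * s v w\<bar> \<le> 1" for y
    using mult_le_one[OF s _ s, of v y v w] by (simp add: abs_mult mult.commute)
  then obtain f where f: "\<And>x. f x = 1 \<or> f x = (-1::real)"
    and gf: "(\<Sum>y\<in>A. \<Sum>x\<in>A. s y x * ((s v y * s v w) * g x)) \<le> (\<Sum>y\<in>A. \<Sum>x\<in>A. s y x * (f y * g x))"
    by (rule sum_bilinear_sharpen_sign[of "\<lambda>y. s v y * s v w" s g A A]) blast
  define T where "T = (\<Sum>x\<in>A. \<Sum>y\<in>A. s x y * (g x * f y))"
  have swap: "(\<Sum>y\<in>A. \<Sum>x\<in>A. s y x * (h y * g x)) = (\<Sum>x\<in>A. \<Sum>y\<in>A. s x y * (g x * h y))" for h
    by (subst sum.swap) (intro sum.cong refl, simp add: sym mult.commute)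
  have T: "(1 - \<gamma>) * n\<^sup>2 \<le> T"
    using vw Kg gf unfolding swap T_def by linarith
  define h where "h x = g x * f x" for x
  have h: "h x = 1 \<or> h x = -1" for x using g[of x] f[of x] by (auto simp: h_def)
  define H where "H = (\<Sum>x\<in>A. h x)"
  \<comment> \<open>Adding the transpose compares \<open>g x * f y\<close> with
    \<open>f x * g y\<close>. They cancel exactly when \<open>h x\<close> and \<open>h y\<close>
    differ, so a large \<open>T\<close> forces \<open>h\<close> to be nearly constant.\<close>
  have "2 * T = T + (\<Sum>y\<in>A. \<Sum>x\<in>A. s y x * (f y * g x))" unfolding swap T_def by simp
  also have "\<dots> = (\<Sum>x\<in>A. \<Sum>y\<in>A. s x y * (g x * f y + f x * g y))"
    unfolding T_def by (simp add: sum.distrib distrib_left)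
  also have "\<dots> \<le> (\<Sum>x\<in>A. \<Sum>y\<in>A. 1 + h x * h y)"
  proof (intro sum_mono)
    fix x y
    show "s x y * (g x * f y + f x * g y) \<le> 1 + h x * h y"
      using g[of x] g[of y] f[of x] f[of y] s[of x y] unfolding h_def by (elim disjE) (simp_all add: abs_le_iff)
  qed
  also have "\<dots> = n\<^sup>2 + H\<^sup>2"
    by (simp add: sum.distrib n_def power2_eq_square H_def sum_product)
  finally have "(1 - 2 * \<gamma>) * n\<^sup>2 \<le> H\<^sup>2" using T by (simp add: algebra_simps)
  moreover have "((1 - 2 * \<gamma>) * n)\<^sup>2 \<le> (1 - 2 * \<gamma>) * n\<^sup>2"
  proof -
    have "(1 - 2 * \<gamma>) * (1 - 2 * \<gamma>) \<le> (1 - 2 * \<gamma>) * 1" using \<gamma> by (intro mult_left_mono) auto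
    then have "(1 - 2 * \<gamma>)\<^sup>2 * n\<^sup>2 \<le> (1 - 2 * \<gamma>) * n\<^sup>2"
      by (intro mult_right_mono) (auto simp: power2_eq_square)
    then show ?thesis by (simp only: power_mult_distrib)
  qed
  ultimately have "((1 - 2 * \<gamma>) * n)\<^sup>2 \<le> \<bar>H\<bar>\<^sup>2" by simp
  then have H: "(1 - 2 * \<gamma>) * n \<le> \<bar>H\<bar>" by (rule power2_le_imp_le) simp
  define \<tau> where "\<tau> = (if H \<ge> 0 then 1 else -1 :: real)"
  have \<tau>: "\<tau> = 1 \<or> \<tau> = -1" by (simp add: \<tau>_def)
  define u where "u x = f x * (\<Sum>y\<in>A. s x y * f y)" for x
  have u: "\<bar>u x\<bar> \<le> n" for x
  proof -
    have "\<bar>u x\<bar> = \<bar>\<Sum>y\<in>A. s x y * f y\<bar>" using f[of x] by (auto simp: u_def)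
    also have "\<dots> \<le> (\<Sum>y\<in>A. \<bar>s x y * f y\<bar>)" by (rule sum_abs)
    also have "\<dots> \<le> (\<Sum>y\<in>A. 1)"
    proof (rule sum_mono)
      show "\<bar>s x y * f y\<bar> \<le> 1" for y using f[of y] s[of x y] by auto
    qed
    finally show ?thesis by (simp add: n_def)
  qed
  \<comment> \<open>Replacing \<open>g\<close> by \<open>\<tau> * f\<close> changes row
    \<open>x\<close> only where \<open>h x\<close> differs from \<open>\<tau>\<close>, and then by
    at most \<open>2 * n\<close>. This costs at most \<open>2 * \<gamma> * n^2\<close> on top of the
    earlier loss \<open>\<gamma> * n^2\<close>, which gives the constant 3.\<close>
  have "T - \<tau> * (\<Sum>x\<in>A. u x) = (\<Sum>x\<in>A. (h x - \<tau>) * u x)"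
  proof -
    have "(\<Sum>y\<in>A. s x y * (g x * f y)) = h x * u x" for x
      using f[of x] by (auto simp: h_def u_def sum_distrib_left mult_ac)
    then show ?thesis by (simp add: T_def sum_distrib_left left_diff_distrib sum_subtractf)
  qed
  also have "\<dots> \<le> (\<Sum>x\<in>A. (1 - \<tau> * h x) * n)"
  proof (rule sum_mono)
    show "(h x - \<tau>) * u x \<le> (1 - \<tau> * h x) * n" for x
      using h[of x] \<tau> u[of x] by (elim disjE) (simp_all add: abs_le_iff)
  qed
  also have "\<dots> = (n - \<tau> * H) * n"
    by (simp add: n_def H_def sum_distrib_left sum_subtractf flip: sum_distrib_right)
  also have "\<dots> = (n - \<bar>H\<bar>) * n" by (simp add: \<tau>_def)
  also have "\<dots> \<le> (2 * \<gamma> * n) * n" using H n by (intro mult_right_mono) (auto simp: algebra_simps)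
  finally have "(1 - 3 * \<gamma>) * n\<^sup>2 \<le> \<tau> * (\<Sum>x\<in>A. u x)"
    using T by (simp add: algebra_simps power2_eq_square)
  also have "(\<Sum>x\<in>A. u x) = (\<Sum>x\<in>A. \<Sum>y\<in>A. s x y * (f x * f y))"
    by (simp add: u_def sum_distrib_left mult_ac)
  finally show ?thesis using that[OF f \<tau>] by (simp add: n_def)
qed

text \<open>Every edge arises from two ordered pairs of vertices; this passes from edge sets to the
  double sums of quadratic forms.\<close>

lemma card_edges_le_sum_pairs:
  assumes fin: "finite V" and D: "D \<subseteq> nsets V 2"
  shows "2 * real (card D) \<le> (\<Sum>x\<in>V. \<Sum>y\<in>V. of_bool ({x, y} \<in> D))"
proof -
  let ?P = "\<lambda>e. {p \<in> V \<times> V. {fst p, snd p} = e}"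
  have finD: "finite D" using D fin finite_imp_finite_nsets finite_subset by blast
  have "card D * 2 = (\<Sum>e\<in>D. 2)" by simp
  also have "\<dots> \<le> (\<Sum>e\<in>D. card (?P e))"
  proof (rule sum_mono)
    fix e assume "e \<in> D"
    then have "e \<in> nsets V 2" using D by blast
    then obtain x y where e: "e = {x, y}" "x \<noteq> y" "x \<in> V" "y \<in> V"
      by (auto simp: nsets_2_eq)
    then have "card {(x, y), (y, x)} \<le> card (?P e)" using fin by (intro card_mono) auto
    then show "2 \<le> card (?P e)" using e by simp
  qed
  also have "\<dots> = card (\<Union>e\<in>D. ?P e)"
    using finD fin by (intro card_UN_disjoint[symmetric]) auto
  also have "(\<Union>e\<in>D. ?P e) = {p \<in> V \<times> V. {fst p, snd p} \<in> D}" by auto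
  finally have "card D * 2 \<le> card {p \<in> V \<times> V. {fst p, snd p} \<in> D}" .
  then have "2 * real (card D) \<le> real (card {p \<in> V \<times> V. {fst p, snd p} \<in> D})" by linarith
  also have "\<dots> = (\<Sum>p\<in>V \<times> V. of_bool ({fst p, snd p} \<in> D))"
    using fin by (simp add: sum.If_cases of_bool_def Int_def)
  finally show ?thesis by (simp add: sum.cartesian_product split_beta)
qed

section \<open>Walk counts and degrees\<close>

locale red_blue_colouring =
  fixes V :: "'a set" and R B :: "'a set set"
  assumes red_blue: "red_blue_complete V R B"
begin

definition red :: "'a \<Rightarrow> 'a \<Rightarrow> real" where "red x y = of_bool ({x, y} \<in> R)"
definition blue :: "'a \<Rightarrow> 'a \<Rightarrow> real" where "blue x y = of_bool ({x, y} \<in> B)"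
definition red_deg :: "'a \<Rightarrow> real" where "red_deg x = (\<Sum>y\<in>V. red x y)"
definition blue_deg :: "'a \<Rightarrow> real" where "blue_deg x = (\<Sum>y\<in>V. blue x y)"
text \<open>Loops carry no colour, so in a red-blue complete graph the diagonal of this matrix is 0
  and all other entries on \<open>V\<close> are 1 or -1.\<close>

definition sign :: "'a \<Rightarrow> 'a \<Rightarrow> real" where "sign x y = red x y - blue x y"
definition imbalance :: "'a \<Rightarrow> real" where "imbalance x = (\<Sum>y\<in>V. sign x y)"
definition correlation :: "'a \<Rightarrow> 'a \<Rightarrow> real" where "correlation x y = (\<Sum>z\<in>V. sign x z * sign y z)"
definition n :: real where "n = real (card V)"

text \<open>These are the entries of the m-th power of RB, the product of the red and the blue
  adjacency matrix.\<close>

fun walk_count :: "nat \<Rightarrow> 'a \<Rightarrow> 'a \<Rightarrow> real" where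
  "walk_count 0 x y = of_bool (x = y)"
| "walk_count (Suc m) x y = (\<Sum>u\<in>V. red x u * (\<Sum>v\<in>V. blue u v * walk_count m v y))"

lemma finite_V: "finite V" and disjoint: "R \<inter> B = {}" and edges: "R \<union> B = nsets V 2"
  using red_blue by (auto simp: red_blue_complete_def)

lemma n_nonneg: "0 \<le> n" by (simp add: n_def)

lemma red_sym: "red x y = red y x" and blue_sym: "blue x y = blue y x"
  by (simp_all add: red_def blue_def insert_commute)

lemma sign_sym: "sign x y = sign y x"
  by (simp add: sign_def red_sym blue_sym)

lemma red_nonneg: "0 \<le> red x y" and blue_nonneg: "0 \<le> blue x y"
  by (simp_all add: red_def blue_def)

lemma edge_iff: "x \<in> V \<Longrightarrow> y \<in> V \<Longrightarrow> {x, y} \<in> R \<union> B \<longleftrightarrow> x \<noteq> y"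
  unfolding edges by (auto simp: nsets_def card_insert_if)

lemma red_plus_blue: "x \<in> V \<Longrightarrow> y \<in> V \<Longrightarrow> red x y + blue x y = of_bool (x \<noteq> y)"
  using edge_iff[of x y] disjoint by (auto simp: red_def blue_def)

lemma abs_sign_le: "\<bar>sign x y\<bar> \<le> 1"
  by (simp add: sign_def red_def blue_def)

lemma degrees: "x \<in> V \<Longrightarrow> red_deg x + blue_deg x = n - 1"
proof -
  assume x: "x \<in> V"
  have "red_deg x + blue_deg x = (\<Sum>y\<in>V. of_bool (x \<noteq> y))"
    unfolding red_deg_def blue_deg_def sum.distrib[symmetric] using x by (intro sum.cong) (auto simp: red_plus_blue)
  also have "\<dots> = (\<Sum>y\<in>V. 1 - of_bool (x = y))" by (intro sum.cong) auto
  also have "\<dots> = n - 1"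
    using x finite_V by (simp add: sum_subtractf n_def of_bool_def)
  finally show ?thesis .
qed

lemma imbalance_eq: "imbalance x = red_deg x - blue_deg x"
  by (simp add: imbalance_def sign_def red_deg_def blue_deg_def sum_subtractf)

lemma red_deg_nonneg: "0 \<le> red_deg x" and blue_deg_nonneg: "0 \<le> blue_deg x"
  by (simp_all add: red_deg_def blue_deg_def sum_nonneg red_nonneg blue_nonneg)

lemma degree_product: "x \<in> V \<Longrightarrow> 4 * (red_deg x * blue_deg x) = (n - 1)\<^sup>2 - (imbalance x)\<^sup>2"
proof -
  assume "x \<in> V"
  then have "n - 1 = red_deg x + blue_deg x" by (simp add: degrees)
  then show ?thesis unfolding imbalance_eq by (simp add: power2_eq_square algebra_simps)
qed

lemma degree_product_le: "x \<in> V \<Longrightarrow> red_deg x * blue_deg x \<le> ((n - 1) / 2)\<^sup>2"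
proof -
  assume "x \<in> V"
  then have "4 * (red_deg x * blue_deg x) \<le> (n - 1)\<^sup>2" by (simp add: degree_product)
  then show ?thesis by (simp add: power_divide)
qed

section \<open>From alternating cycles to the trace of a matrix power\<close>

text \<open>Stripping the first red and blue edge reproduces the recursion of
  \<open>walk_count\<close>; a union bound over the two vertices removed suffices.\<close>

lemma card_alt_walks_le:
  assumes "x \<in> V"
  shows "real (card (alt_walks V R B m x y)) \<le> walk_count m x y"
  using assms
proof (induction m arbitrary: x)
  case 0
  have "alt_walks V R B 0 x y = (if x = y then {[]} else {})"
    by (auto simp: alt_walks_def)
  then show ?case by simp
next
  case (Suc m)
  let ?W = "\<lambda>u v. if {x, u} \<in> R \<and> {u, v} \<in> B then (\<lambda>ws. u # v # ws) ` alt_walks V R B m v y else {}"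
  have "alt_walks V R B (Suc m) x y \<subseteq> (\<Union>u\<in>V. \<Union>v\<in>V. ?W u v)"
  proof
    fix ws assume ws: "ws \<in> alt_walks V R B (Suc m) x y"
    then obtain u v us where "ws = u # v # us" by (auto simp: alt_walks_def length_Suc_conv)
    then show "ws \<in> (\<Union>u\<in>V. \<Union>v\<in>V. ?W u v)" using ws by (auto simp: alt_walks_def)
  qed
  then have "card (alt_walks V R B (Suc m) x y) \<le> card (\<Union>u\<in>V. \<Union>v\<in>V. ?W u v)"
    by (intro card_mono) (auto simp: finite_V finite_alt_walks)
  also have "\<dots> \<le> (\<Sum>u\<in>V. \<Sum>v\<in>V. card (?W u v))"
    by (intro order.trans[OF card_UN_le] sum_mono finite_V order.refl)
  finally have "real (card (alt_walks V R B (Suc m) x y)) \<le> (\<Sum>u\<in>V. \<Sum>v\<in>V. real (card (?W u v)))"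
    by (simp flip: of_nat_sum)
  also have "\<dots> \<le> (\<Sum>u\<in>V. \<Sum>v\<in>V. red x u * (blue u v * walk_count m v y))"
  proof (intro sum_mono)
    fix u v assume "v \<in> V"
    have "real (card ((\<lambda>ws. u # v # ws) ` alt_walks V R B m v y)) = real (card (alt_walks V R B m v y))"
      by (subst card_image) (auto intro: inj_onI)
    also have "\<dots> \<le> walk_count m v y" by (rule Suc.IH) fact
    finally show "real (card (?W u v)) \<le> red x u * (blue u v * walk_count m v y)"
      by (simp add: red_def blue_def)
  qed
  finally show ?case by (simp add: sum_distrib_left)
qed

lemma alternating_cycles_le_walk_count:
  assumes "t \<ge> 1"
  shows "real (4 * t) * real (card (alternating_cycles V R B (4 * t))) \<le> (\<Sum>x\<in>V. walk_count (2 * t) x x)"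
proof -
  have "4 * t * card (alternating_cycles V R B (4 * t)) \<le> card (red_start_cycles V R B (4 * t))"
    using assms by (intro card_alternating_cycles_le finite_V disjoint) auto
  also have "\<dots> \<le> (\<Sum>x\<in>V. card (alt_walks V R B (2 * t) x x))"
    using card_red_start_cycles_le[OF finite_V, of "2 * t" R B] assms by simp
  finally have "real (4 * t * card (alternating_cycles V R B (4 * t)))
      \<le> real (\<Sum>x\<in>V. card (alt_walks V R B (2 * t) x x))"
    by (rule of_nat_mono)
  also have "\<dots> \<le> (\<Sum>x\<in>V. walk_count (2 * t) x x)"
    unfolding of_nat_sum by (intro sum_mono card_alt_walks_le)
  finally show ?thesis by simp
qed

section \<open>Contraction in degree-weighted norms and the trace bound\<close>

text \<open>The output weights of a red step are the input weights of a blue step and conversely. A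
  blue step followed by a red one therefore multiplies the squared norm with weights
  \<open>blue_deg\<close> by at most ((n - 1) / 2)^4.\<close>

lemma red_contraction:
  "(\<Sum>x\<in>V. blue_deg x * (\<Sum>y\<in>V. red x y * v y)\<^sup>2) \<le> ((n - 1) / 2)\<^sup>2 * (\<Sum>y\<in>V. red_deg y * (v y)\<^sup>2)"
  unfolding red_deg_def
  by (rule weighted_norm_contraction[OF red_nonneg red_sym blue_deg_nonneg])
    (use degree_product_le in \<open>simp add: red_deg_def mult.commute\<close>)

lemma blue_contraction:
  "(\<Sum>x\<in>V. red_deg x * (\<Sum>y\<in>V. blue x y * v y)\<^sup>2) \<le> ((n - 1) / 2)\<^sup>2 * (\<Sum>y\<in>V. blue_deg y * (v y)\<^sup>2)"
  unfolding blue_deg_def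
  by (rule weighted_norm_contraction[OF blue_nonneg blue_sym red_deg_nonneg])
    (use degree_product_le in \<open>simp add: blue_deg_def\<close>)

text \<open>This is the squared Hilbert-Schmidt norm of (RB)^m with rows weighted by the blue
  degrees.\<close>

definition walk_norm :: "nat \<Rightarrow> real" where
  "walk_norm m = (\<Sum>y\<in>V. \<Sum>x\<in>V. blue_deg x * (walk_count m x y)\<^sup>2)"

lemma walk_norm_Suc: "walk_norm (Suc m) \<le> ((n - 1) / 2) ^ 4 * walk_norm m"
proof -
  let ?p = "((n - 1) / 2)\<^sup>2"
  have "(\<Sum>x\<in>V. blue_deg x * (walk_count (Suc m) x y)\<^sup>2) \<le> ?p * (?p * (\<Sum>x\<in>V. blue_deg x * (walk_count m x y)\<^sup>2))" for y
    unfolding walk_count.simps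
    by (intro order.trans[OF red_contraction] mult_left_mono blue_contraction) simp
  then have "walk_norm (Suc m) \<le> (\<Sum>y\<in>V. ?p * (?p * (\<Sum>x\<in>V. blue_deg x * (walk_count m x y)\<^sup>2)))"
    unfolding walk_norm_def by (intro sum_mono)
  also have "\<dots> = ((n - 1) / 2) ^ 4 * walk_norm m"
    unfolding walk_norm_def sum_distrib_left[symmetric] by (simp add: power4_eq_xxxx power2_eq_square)
  finally show ?thesis .
qed

text \<open>The iteration stops at \<open>walk_norm 1\<close> instead of 0, because a lower bound on
  \<open>walk_norm 1\<close> is what near-extremality has to provide.\<close>

lemma walk_norm_le: "walk_norm (Suc m) \<le> ((n - 1) / 2) ^ (4 * m) * walk_norm 1"
proof (induction m)
  case (Suc m)
  have "walk_norm (Suc (Suc m)) \<le> ((n - 1) / 2) ^ 4 * walk_norm (Suc m)" by (rule walk_norm_Suc)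
  also have "\<dots> \<le> ((n - 1) / 2) ^ 4 * (((n - 1) / 2) ^ (4 * m) * walk_norm 1)"
    by (intro mult_left_mono Suc.IH) simp
  also have "\<dots> = ((n - 1) / 2) ^ (4 * Suc m) * walk_norm 1"
    by (simp add: power_add)
  finally show ?case .
qed simp

text \<open>Weighted AM-GM for a single red edge. Summed over \<open>x\<close>, the first term gives
  at most \<open>c\<close> for each \<open>u\<close>, and the second has the weight that
  \<open>blue_contraction\<close> requires; \<open>c\<close> is left free to balance the
  two.\<close>

lemma red_mult_le:
  assumes "x \<in> V" "u \<in> V" "c > 0"
  shows "2 * (red x u * k) \<le> c * (red u x / red_deg u) + red_deg u * k\<^sup>2 / c"
proof (cases "red x u = 0")
  case True
  then show ?thesis using assms red_deg_nonneg[of u] red_sym[of u x] by simp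
next
  case False
  then have r: "red x u = 1" "red u x = 1" by (auto simp: red_def insert_commute)
  have "red u x \<le> red_deg u"
    unfolding red_deg_def by (rule member_le_sum) (use assms finite_V red_nonneg in auto)
  then have d: "red_deg u > 0" using r by simp
  have "0 \<le> (c - red_deg u * k)\<^sup>2 / (c * red_deg u)" using d assms by simp
  also have "\<dots> = c / red_deg u + red_deg u * k\<^sup>2 / c - 2 * k"
    using d assms by (simp add: field_simps power2_eq_square)
  finally show ?thesis using r by simp
qed

lemma closed_walks_le:
  assumes t: "t \<ge> 2" and n: "n > 1"
  shows "2 * (\<Sum>x\<in>V. walk_count (2 * t) x x)
    \<le> n * ((n - 1) / 2) ^ (4 * t - 1) + ((n - 1) / 2) ^ (4 * t - 5) * walk_norm 1"
proof -
  define p where "p = (n - 1) / 2"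
  have p: "p > 0" using n by (simp add: p_def)
  \<comment> \<open>With \<open>walk_norm 1\<close> at its largest possible value n * p^4, this
    choice makes the two AM-GM terms equal.\<close>
  define c where "c = p ^ (4 * t - 1)"
  have c: "c > 0" using p by (simp add: c_def)
  define K where "K u x = (\<Sum>v\<in>V. blue u v * walk_count (2 * t - 1) v x)" for u x
  have Suc2t: "2 * t = Suc (2 * t - 1)" "2 * t - 1 = Suc (2 * t - 2)" using t by auto
  have "2 * (\<Sum>x\<in>V. walk_count (2 * t) x x) = (\<Sum>x\<in>V. \<Sum>u\<in>V. 2 * (red x u * K u x))"
    unfolding K_def by (subst Suc2t(1), subst walk_count.simps(2)) (simp add: sum_distrib_left)
  also have "\<dots> \<le> (\<Sum>x\<in>V. \<Sum>u\<in>V. c * (red u x / red_deg u) + red_deg u * (K u x)\<^sup>2 / c)"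
    by (intro sum_mono red_mult_le c)
  also have "\<dots> = c * (\<Sum>u\<in>V. \<Sum>x\<in>V. red u x / red_deg u) + (\<Sum>x\<in>V. \<Sum>u\<in>V. red_deg u * (K u x)\<^sup>2) / c"
    unfolding sum.distrib by (subst sum.swap) (simp add: sum_distrib_left sum_divide_distrib)
  also have "\<dots> \<le> c * n + (p ^ (8 * t - 6) * walk_norm 1) / c"
  proof (intro add_mono mult_left_mono divide_right_mono)
    have "(\<Sum>u\<in>V. \<Sum>x\<in>V. red u x / red_deg u) = (\<Sum>u\<in>V. red_deg u / red_deg u)"
      by (simp add: red_deg_def flip: sum_divide_distrib)
    \<comment> \<open>Only an inequality: a vertex without red edges contributes 0 / 0, which is
      0.\<close>
    also have "\<dots> \<le> (\<Sum>u\<in>V. 1)" by (intro sum_mono) simp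
    finally show "(\<Sum>u\<in>V. \<Sum>x\<in>V. red u x / red_deg u) \<le> n" by (simp add: n_def)
    have "(\<Sum>x\<in>V. \<Sum>u\<in>V. red_deg u * (K u x)\<^sup>2)
        \<le> (\<Sum>x\<in>V. p\<^sup>2 * (\<Sum>y\<in>V. blue_deg y * (walk_count (2 * t - 1) y x)\<^sup>2))"
      unfolding K_def p_def by (intro sum_mono blue_contraction)
    also have "\<dots> = p\<^sup>2 * walk_norm (2 * t - 1)" by (simp add: walk_norm_def sum_distrib_left)
    also have "\<dots> \<le> p\<^sup>2 * (p ^ (4 * (2 * t - 2)) * walk_norm 1)"
      unfolding p_def by (subst Suc2t(2), intro mult_left_mono walk_norm_le) simp
    also have "\<dots> = p ^ (8 * t - 6) * walk_norm 1"
    proof -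
      have "8 * t - 6 = 2 + 4 * (2 * t - 2)" using t by simp
      then show ?thesis by (simp only: power_add mult.assoc)
    qed
    finally show "(\<Sum>x\<in>V. \<Sum>u\<in>V. red_deg u * (K u x)\<^sup>2) \<le> p ^ (8 * t - 6) * walk_norm 1" .
  qed (use c in auto)
  also have "(p ^ (8 * t - 6) * walk_norm 1) / c = p ^ (4 * t - 5) * walk_norm 1"
  proof -
    have "8 * t - 6 = (4 * t - 5) + (4 * t - 1)" using t by simp
    then have "p ^ (8 * t - 6) = p ^ (4 * t - 5) * c" by (simp only: c_def power_add)
    then show ?thesis using c by simp
  qed
  finally show ?thesis by (simp add: c_def p_def mult.commute)
qed

text \<open>The trace is at most the mean of the extremal value n * p^(4t-1), where p is (n - 1) /
  2, and a multiple of \<open>walk_norm 1\<close>. A relative deficit \<epsilon> of the trace thus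
  becomes at most 2\<epsilon> in \<open>walk_norm 1\<close>.\<close>

lemma walk_norm_1_ge:
  assumes t: "t \<ge> 2" and n: "n > 1"
    and many: "real (card (alternating_cycles V R B (4 * t)))
       > (1 - \<epsilon>) * (n / real (4 * t)) * ((n - 1) / 2) ^ (4 * t - 1)"
  shows "walk_norm 1 \<ge> (1 - 2 * \<epsilon>) * n * ((n - 1) / 2) ^ 4"
proof -
  define p where "p = (n - 1) / 2"
  have p: "p > 0" using n by (simp add: p_def)
  have "(1 - \<epsilon>) * n * p ^ (4 * t - 1) = real (4 * t) * ((1 - \<epsilon>) * (n / real (4 * t)) * p ^ (4 * t - 1))"
    using t by (simp add: field_simps)
  also have "\<dots> \<le> real (4 * t) * real (card (alternating_cycles V R B (4 * t)))"
    using many by (intro mult_left_mono) (auto simp: p_def)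
  also have "\<dots> \<le> (\<Sum>x\<in>V. walk_count (2 * t) x x)"
    using t by (intro alternating_cycles_le_walk_count) simp
  finally have "2 * ((1 - \<epsilon>) * n * p ^ (4 * t - 1)) \<le> n * p ^ (4 * t - 1) + p ^ (4 * t - 5) * walk_norm 1"
    using closed_walks_le[OF t n] by (simp add: p_def)
  moreover have "p ^ (4 * t - 1) = p ^ (4 * t - 5) * p ^ 4"
  proof -
    have "4 * t - 1 = (4 * t - 5) + 4" using t by simp
    then show ?thesis by (simp only: power_add)
  qed
  ultimately have "p ^ (4 * t - 5) * ((1 - 2 * \<epsilon>) * n * p ^ 4) \<le> p ^ (4 * t - 5) * walk_norm 1"
    by (simp add: algebra_simps)
  then show ?thesis using p by (simp add: p_def)
qed

section \<open>Near-extremal colourings have balanced degrees\<close>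

lemma walk_count_1: "y \<in> V \<Longrightarrow> walk_count 1 x y = (\<Sum>u\<in>V. red x u * blue u y)"
proof -
  assume "y \<in> V"
  then have "(\<Sum>v\<in>V. blue u v * of_bool (v = y)) = blue u y" for u
    using finite_V by (simp add: of_bool_def if_distrib cong: if_cong)
  then show ?thesis by simp
qed

text \<open>Only the red step is contracted. Summing the blue step exactly, with squares of 0/1
  entries, keeps the degree products visible.\<close>

lemma walk_norm_1_le_degrees: "walk_norm 1 \<le> ((n - 1) / 2)\<^sup>2 * (\<Sum>x\<in>V. red_deg x * blue_deg x)"
proof -
  have "walk_norm 1 = (\<Sum>y\<in>V. \<Sum>x\<in>V. blue_deg x * (\<Sum>u\<in>V. red x u * blue u y)\<^sup>2)"
    unfolding walk_norm_def by (intro sum.cong refl) (simp only: walk_count_1)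
  also have "\<dots> \<le> (\<Sum>y\<in>V. ((n - 1) / 2)\<^sup>2 * (\<Sum>x\<in>V. red_deg x * (blue x y)\<^sup>2))"
    by (intro sum_mono red_contraction)
  also have "\<dots> = ((n - 1) / 2)\<^sup>2 * (\<Sum>y\<in>V. \<Sum>x\<in>V. red_deg x * blue x y)"
  proof -
    have "(blue x y)\<^sup>2 = blue x y" for x y by (simp add: blue_def)
    then show ?thesis by (simp add: sum_distrib_left)
  qed
  also have "(\<Sum>y\<in>V. \<Sum>x\<in>V. red_deg x * blue x y) = (\<Sum>x\<in>V. red_deg x * blue_deg x)"
    by (subst sum.swap) (simp add: blue_deg_def sum_distrib_left)
  finally show ?thesis .
qed

text \<open>By \<open>degree_product\<close>, each squared imbalance is four times the amount by
  which the degree product falls short of its maximum, and the total shortfall is controlled by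
  \<open>walk_norm 1\<close>.\<close>

lemma sum_imbalance_sq_le:
  assumes n: "n > 1" and \<epsilon>: "\<epsilon> \<ge> 0" and W: "walk_norm 1 \<ge> (1 - 2 * \<epsilon>) * n * ((n - 1) / 2) ^ 4"
  shows "(\<Sum>x\<in>V. (imbalance x)\<^sup>2) \<le> 2 * \<epsilon> * n ^ 3"
proof -
  define q where "q = ((n - 1) / 2)\<^sup>2"
  have q: "q > 0" using n by (simp add: q_def)
  have "((n - 1) / 2) ^ 4 = q * q" by (simp add: q_def power4_eq_xxxx power2_eq_square)
  then have "q * ((1 - 2 * \<epsilon>) * n * q) \<le> q * (\<Sum>x\<in>V. red_deg x * blue_deg x)"
    using W walk_norm_1_le_degrees by (simp add: q_def[symmetric] mult_ac)
  then have 1: "(1 - 2 * \<epsilon>) * n * q \<le> (\<Sum>x\<in>V. red_deg x * blue_deg x)" using q by simp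
  have "4 * (\<Sum>x\<in>V. red_deg x * blue_deg x) = (\<Sum>x\<in>V. (n - 1)\<^sup>2 - (imbalance x)\<^sup>2)"
    unfolding sum_distrib_left by (intro sum.cong) (auto simp: degree_product)
  also have "\<dots> = 4 * q * n - (\<Sum>x\<in>V. (imbalance x)\<^sup>2)"
    by (simp add: sum_subtractf n_def[symmetric] q_def power_divide)
  finally have "(\<Sum>x\<in>V. (imbalance x)\<^sup>2) \<le> 2 * \<epsilon> * n * (4 * q)"
    using 1 by (simp add: algebra_simps)
  also have "\<dots> \<le> 2 * \<epsilon> * n * n\<^sup>2"
    using n \<epsilon> by (intro mult_left_mono) (auto simp: q_def power_divide intro!: power_mono)
  finally show ?thesis by (simp add: power3_eq_cube power2_eq_square)
qed

lemma sum_abs_imbalance_le: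
  assumes n: "n > 1" and \<epsilon>: "\<epsilon> \<ge> 0" and S: "(\<Sum>x\<in>V. (imbalance x)\<^sup>2) \<le> 2 * \<epsilon> * n ^ 3"
  shows "(\<Sum>x\<in>V. \<bar>imbalance x\<bar>) \<le> 2 * sqrt \<epsilon> * n\<^sup>2"
proof -
  have "(\<Sum>x\<in>V. \<bar>imbalance x\<bar>)\<^sup>2 \<le> n * (\<Sum>x\<in>V. (imbalance x)\<^sup>2)"
    using weighted_Cauchy_Schwarz[of V "\<lambda>_. 1" "\<lambda>x. \<bar>imbalance x\<bar>"] by (simp add: n_def)
  also have "\<dots> \<le> n * (2 * \<epsilon> * n ^ 3)" by (intro mult_left_mono S n_nonneg)
  also have "\<dots> \<le> 4 * \<epsilon> * n ^ 4" using \<epsilon> n by (simp add: power_eq_if)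
  also have "\<dots> = (2 * sqrt \<epsilon> * n\<^sup>2)\<^sup>2" using \<epsilon> by (simp add: power_mult_distrib)
  finally show ?thesis by (rule power2_le_imp_le) (use \<epsilon> in simp)
qed

section \<open>Codegrees and the fourth moment of the sign matrix\<close>

text \<open>The imbalances cancel in the product of the red and the blue codegree, up to a negative square.\<close>

lemma sum_walk_count_1_sq_le:
  "(\<Sum>y\<in>V. \<Sum>x\<in>V. (walk_count 1 x y)\<^sup>2) \<le> (\<Sum>u\<in>V. \<Sum>v\<in>V. (n + correlation u v)\<^sup>2) / 16"
proof -
  let ?cr = "\<lambda>u v. \<Sum>x\<in>V. red u x * red v x" and ?cb = "\<lambda>u v. \<Sum>x\<in>V. blue u x * blue v x"
  have "(\<Sum>y\<in>V. \<Sum>x\<in>V. (walk_count 1 x y)\<^sup>2)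
      = (\<Sum>y\<in>V. \<Sum>x\<in>V. \<Sum>u\<in>V. \<Sum>v\<in>V. (red u x * red v x) * (blue u y * blue v y))"
  proof (intro sum.cong refl)
    fix x y assume "y \<in> V"
    then show "(walk_count 1 x y)\<^sup>2 = (\<Sum>u\<in>V. \<Sum>v\<in>V. (red u x * red v x) * (blue u y * blue v y))"
      unfolding power2_eq_square by (simp only: walk_count_1 sum_product) (simp add: red_sym[of x] mult_ac)
  qed
  also have "\<dots> = (\<Sum>y\<in>V. \<Sum>u\<in>V. \<Sum>x\<in>V. \<Sum>v\<in>V. (red u x * red v x) * (blue u y * blue v y))"
    by (intro sum.cong refl sum.swap)
  also have "\<dots> = (\<Sum>u\<in>V. \<Sum>y\<in>V. \<Sum>v\<in>V. \<Sum>x\<in>V. (red u x * red v x) * (blue u y * blue v y))"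
    by (subst sum.swap) (intro sum.cong refl sum.swap)
  also have "\<dots> = (\<Sum>u\<in>V. \<Sum>v\<in>V. \<Sum>y\<in>V. \<Sum>x\<in>V. (red u x * red v x) * (blue u y * blue v y))"
    by (intro sum.cong refl sum.swap)
  also have "\<dots> = (\<Sum>u\<in>V. \<Sum>v\<in>V. ?cr u v * ?cb u v)"
    by (simp only: sum_product) (intro sum.cong refl sum.swap)
  also have "\<dots> \<le> (\<Sum>u\<in>V. \<Sum>v\<in>V. (n + correlation u v)\<^sup>2 / 16)"
  proof (intro sum_mono)
    fix u v assume uv: "u \<in> V" "v \<in> V"
    define a where "a = imbalance u + imbalance v"
    \<comment> \<open>Equality holds off the diagonal; on it \<open>red\<close>, \<open>blue\<close>
      and \<open>sign\<close> all vanish.\<close>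
    have le: "2 * red x y \<le> 1 + sign x y" "2 * blue x y \<le> 1 - sign x y" if "x \<in> V" "y \<in> V" for x y
      using red_plus_blue[OF that] by (auto simp: sign_def of_bool_def split: if_splits)
    have "4 * ?cr u v = (\<Sum>x\<in>V. (2 * red u x) * (2 * red v x))"
      by (simp add: sum_distrib_left mult_ac)
    also have "\<dots> \<le> (\<Sum>x\<in>V. (1 + sign u x) * (1 + sign v x))"
      using uv le abs_sign_le[of u] by (intro sum_mono mult_mono) (auto simp: red_nonneg abs_le_iff intro: order.trans[OF _ le(1)])
    also have "\<dots> = (n + correlation u v) + a"
      by (simp add: algebra_simps sum.distrib n_def correlation_def imbalance_def a_def)
    finally have 1: "4 * ?cr u v \<le> (n + correlation u v) + a" .
    have "4 * ?cb u v = (\<Sum>x\<in>V. (2 * blue u x) * (2 * blue v x))"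
      by (simp add: sum_distrib_left mult_ac)
    also have "\<dots> \<le> (\<Sum>x\<in>V. (1 - sign u x) * (1 - sign v x))"
      using uv le abs_sign_le[of u] by (intro sum_mono mult_mono) (auto simp: blue_nonneg abs_le_iff)
    also have "\<dots> = (n + correlation u v) - a"
      by (simp add: algebra_simps sum.distrib sum_subtractf n_def correlation_def imbalance_def a_def)
    finally have 2: "4 * ?cb u v \<le> (n + correlation u v) - a" .
    have nn: "0 \<le> 4 * ?cr u v" "0 \<le> 4 * ?cb u v"
      by (simp_all add: sum_nonneg red_nonneg blue_nonneg)
    have "(4 * ?cr u v) * (4 * ?cb u v) \<le> ((n + correlation u v) + a) * ((n + correlation u v) - a)"
      using 1 2 nn by (intro mult_mono) auto
    also have "\<dots> = (n + correlation u v)\<^sup>2 - a\<^sup>2" by (simp add: power2_eq_square algebra_simps)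
    also have "\<dots> \<le> (n + correlation u v)\<^sup>2" by simp
    finally show "?cr u v * ?cb u v \<le> (n + correlation u v)\<^sup>2 / 16" by simp
  qed
  finally show ?thesis by (simp add: sum_divide_distrib)
qed

text \<open>The weight \<open>blue_deg x\<close> is replaced by n / 2 at the cost of half the
  absolute imbalance of \<open>x\<close>, multiplied by the trivial bound n^2 on a squared entry of
  RB.\<close>

lemma walk_norm_1_le_correlation:
  "walk_norm 1 \<le> n / 32 * (\<Sum>u\<in>V. \<Sum>v\<in>V. (n + correlation u v)\<^sup>2) + n ^ 3 / 2 * (\<Sum>x\<in>V. \<bar>imbalance x\<bar>)"
proof -
  have wc: "0 \<le> walk_count 1 x y" "walk_count 1 x y \<le> n" if "y \<in> V" for x y
  proof -
    have "red x u * blue u y \<le> 1" for u by (simp add: red_def blue_def)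
    then have "(\<Sum>u\<in>V. red x u * blue u y) \<le> (\<Sum>u\<in>V. 1)" by (intro sum_mono)
    then show "0 \<le> walk_count 1 x y" "walk_count 1 x y \<le> n"
      using that by (simp_all only: walk_count_1) (simp_all add: n_def sum_nonneg red_nonneg blue_nonneg)
  qed
  have "walk_norm 1 \<le> (\<Sum>y\<in>V. \<Sum>x\<in>V. n / 2 * (walk_count 1 x y)\<^sup>2 + \<bar>imbalance x\<bar> / 2 * n\<^sup>2)"
    unfolding walk_norm_def
  proof (intro sum_mono)
    fix x y assume xy: "x \<in> V" "y \<in> V"
    have "blue_deg x \<le> n / 2 + \<bar>imbalance x\<bar> / 2"
      using degrees[OF xy(1)] imbalance_eq[of x] abs_ge_minus_self[of "imbalance x"] by linarith
    then have "blue_deg x * (walk_count 1 x y)\<^sup>2 \<le> (n / 2 + \<bar>imbalance x\<bar> / 2) * (walk_count 1 x y)\<^sup>2"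
      by (intro mult_right_mono) auto
    also have "\<dots> \<le> n / 2 * (walk_count 1 x y)\<^sup>2 + \<bar>imbalance x\<bar> / 2 * n\<^sup>2"
      unfolding distrib_right using wc[OF xy(2)] by (intro add_mono mult_left_mono power_mono order.refl) auto
    finally show "blue_deg x * (walk_count 1 x y)\<^sup>2 \<le> n / 2 * (walk_count 1 x y)\<^sup>2 + \<bar>imbalance x\<bar> / 2 * n\<^sup>2" .
  qed
  also have "\<dots> = n / 2 * (\<Sum>y\<in>V. \<Sum>x\<in>V. (walk_count 1 x y)\<^sup>2) + n ^ 3 / 2 * (\<Sum>x\<in>V. \<bar>imbalance x\<bar>)"
    by (simp add: sum.distrib n_def[symmetric] power3_eq_cube power2_eq_square
        del: One_nat_def walk_count.simps flip: sum_distrib_left sum_distrib_right sum_divide_distrib)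
  also have "\<dots> \<le> n / 2 * ((\<Sum>u\<in>V. \<Sum>v\<in>V. (n + correlation u v)\<^sup>2) / 16) + n ^ 3 / 2 * (\<Sum>x\<in>V. \<bar>imbalance x\<bar>)"
    by (intro add_mono mult_left_mono sum_walk_count_1_sq_le) (use n_nonneg in auto)
  finally show ?thesis by simp
qed

text \<open>Both sides are the squared norm of S applied to the all-ones vector, S being the sign
  matrix. This makes the linear term small when (n + c)^2 is expanded.\<close>

lemma sum_correlation: "(\<Sum>u\<in>V. \<Sum>v\<in>V. correlation u v) = (\<Sum>x\<in>V. (imbalance x)\<^sup>2)"
proof -
  have "(\<Sum>u\<in>V. \<Sum>v\<in>V. correlation u v) = (\<Sum>u\<in>V. \<Sum>x\<in>V. \<Sum>v\<in>V. sign u x * sign v x)"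
    unfolding correlation_def by (intro sum.cong refl sum.swap)
  also have "\<dots> = (\<Sum>x\<in>V. \<Sum>u\<in>V. \<Sum>v\<in>V. sign x u * sign x v)"
    by (subst sum.swap) (simp only: sign_sym)
  also have "\<dots> = (\<Sum>x\<in>V. (imbalance x)\<^sup>2)"
    by (simp add: imbalance_def power2_eq_square sum_product)
  finally show ?thesis .
qed

lemma sum_correlation_sq_ge:
  assumes \<epsilon>: "0 < \<epsilon>" "\<epsilon> \<le> 1 / 2" and n: "n > 1" "4 / \<epsilon> \<le> n"
    and W: "walk_norm 1 \<ge> (1 - 2 * \<epsilon>) * n * ((n - 1) / 2) ^ 4"
  shows "(\<Sum>u\<in>V. \<Sum>v\<in>V. (correlation u v)\<^sup>2) \<ge> (1 - 50 * sqrt \<epsilon>) * n ^ 4"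
proof -
  define Q where "Q = (\<Sum>u\<in>V. \<Sum>v\<in>V. (correlation u v)\<^sup>2)"
  have S: "(\<Sum>x\<in>V. (imbalance x)\<^sup>2) \<le> 2 * \<epsilon> * n ^ 3" using sum_imbalance_sq_le[OF n(1) _ W] \<epsilon> by simp
  have A: "(\<Sum>x\<in>V. \<bar>imbalance x\<bar>) \<le> 2 * sqrt \<epsilon> * n\<^sup>2" using sum_abs_imbalance_le[OF n(1) _ S] \<epsilon> by simp
  have "(\<Sum>u\<in>V. \<Sum>v\<in>V. (n + correlation u v)\<^sup>2) = n ^ 4 + 2 * n * (\<Sum>x\<in>V. (imbalance x)\<^sup>2) + Q"
    unfolding sum_correlation[symmetric] Q_def
    by (simp add: power2_sum sum.distrib n_def[symmetric] sum_distrib_left[symmetric])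
      (simp add: power4_eq_xxxx power2_eq_square)
  also have "\<dots> \<le> n ^ 4 + 2 * n * (2 * \<epsilon> * n ^ 3) + Q"
    using n by (intro add_mono mult_left_mono S) auto
  also have "\<dots> = (1 + 4 * \<epsilon>) * n ^ 4 + Q" by (simp add: power_eq_if algebra_simps)
  finally have sq: "(\<Sum>u\<in>V. \<Sum>v\<in>V. (n + correlation u v)\<^sup>2) \<le> (1 + 4 * \<epsilon>) * n ^ 4 + Q" .
  \<comment> \<open>Bernoulli's inequality replaces n - 1 by n; this is the purpose of the bound
    \<open>4 / \<epsilon> \<le> n\<close>.\<close>
  have "(1 - \<epsilon>) * n ^ 4 \<le> (n - 1) ^ 4"
  proof -
    have "4 \<le> \<epsilon> * n" using n \<epsilon> by (simp add: field_simps)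
    then have "(1 - \<epsilon>) \<le> 1 + real 4 * (- 1 / n)" using n by (simp add: field_simps)
    also have "\<dots> \<le> (1 + (- 1 / n)) ^ 4" using n by (intro Bernoulli_inequality) (simp add: field_simps)
    also have "\<dots> = (n - 1) ^ 4 / n ^ 4" using n by (simp add: field_simps flip: power_divide)
    finally show ?thesis using n by (simp add: field_simps)
  qed
  then have "(1 - 2 * \<epsilon>) * ((1 - \<epsilon>) * n ^ 4) \<le> (1 - 2 * \<epsilon>) * (n - 1) ^ 4"
    using \<epsilon> by (intro mult_left_mono) auto
  moreover have "(1 - 3 * \<epsilon>) * n ^ 4 \<le> (1 - 2 * \<epsilon>) * (1 - \<epsilon>) * n ^ 4"
    using n by (intro mult_right_mono) (auto simp: algebra_simps)
  ultimately have "(1 - 3 * \<epsilon>) * n ^ 4 / 16 \<le> (1 - 2 * \<epsilon>) * ((n - 1) / 2) ^ 4"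
    by (simp add: power_divide mult.assoc)
  then have "n * ((1 - 3 * \<epsilon>) * n ^ 4 / 16) \<le> n * ((1 - 2 * \<epsilon>) * ((n - 1) / 2) ^ 4)"
    by (intro mult_left_mono n_nonneg)
  also have "\<dots> = (1 - 2 * \<epsilon>) * n * ((n - 1) / 2) ^ 4" by (simp add: mult_ac)
  also note W
  also note walk_norm_1_le_correlation
  also have "n / 32 * (\<Sum>u\<in>V. \<Sum>v\<in>V. (n + correlation u v)\<^sup>2) + n ^ 3 / 2 * (\<Sum>x\<in>V. \<bar>imbalance x\<bar>)
      \<le> n / 32 * ((1 + 4 * \<epsilon>) * n ^ 4 + Q) + n ^ 3 / 2 * (2 * sqrt \<epsilon> * n\<^sup>2)"
    using n by (intro add_mono mult_left_mono sq A) auto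
  finally have "n * (2 * (1 - 3 * \<epsilon>) * n ^ 4) \<le> n * ((1 + 4 * \<epsilon>) * n ^ 4 + Q + 32 * sqrt \<epsilon> * n ^ 4)"
    by (simp add: algebra_simps power_eq_if)
  then have 3: "2 * (1 - 3 * \<epsilon>) * n ^ 4 \<le> (1 + 4 * \<epsilon>) * n ^ 4 + Q + 32 * sqrt \<epsilon> * n ^ 4"
    using n by simp
  \<comment> \<open>The loss is 10 \<epsilon> plus 32 times its square root; as \<epsilon> is at
    most its root, 50 roots cover both.\<close>
  have "\<epsilon> * \<epsilon> \<le> \<epsilon> * 1" using \<epsilon> by (intro mult_left_mono) auto
  then have "\<epsilon> \<le> sqrt \<epsilon>" using \<epsilon> by (intro real_le_rsqrt) (simp add: power2_eq_square)
  then have "\<epsilon> * n ^ 4 \<le> sqrt \<epsilon> * n ^ 4" using n by (intro mult_right_mono) auto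
  moreover have "0 \<le> sqrt \<epsilon> * n ^ 4" using \<epsilon> n by simp
  moreover have "n ^ 4 \<le> Q + 10 * (\<epsilon> * n ^ 4) + 32 * (sqrt \<epsilon> * n ^ 4)"
    using 3 by (simp add: algebra_simps)
  moreover have "(1 - 50 * sqrt \<epsilon>) * n ^ 4 = n ^ 4 - 50 * (sqrt \<epsilon> * n ^ 4)" by (simp add: algebra_simps)
  ultimately show ?thesis unfolding Q_def[symmetric] by linarith
qed

section \<open>Reading off the bipartition\<close>

text \<open>If \<open>\<tau>\<close> is 1, then \<open>sign x y\<close> mostly equals
  \<open>f x * f y\<close>, so edges between the parts tend to be blue; otherwise they tend to be
  red. A wrong edge contributes 2 to the deficit for each of its two orderings, hence the factor
  4.\<close>

lemma card_sym_diff_bipartite_le: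
  assumes f: "\<And>x. f x = 1 \<or> f x = (-1::real)" and \<tau>: "\<tau> = 1 \<or> \<tau> = (-1::real)"
    and XY: "X = {x \<in> V. f x = 1}" "Y = {x \<in> V. f x = -1}"
    and sum: "(1 - \<eta>) * n\<^sup>2 \<le> \<tau> * (\<Sum>x\<in>V. \<Sum>y\<in>V. sign x y * (f x * f y))"
  shows "4 * real (card (sym_diff (if \<tau> = 1 then B else R) (complete_bipartite_edges X Y))) \<le> \<eta> * n\<^sup>2"
proof -
  let ?E = "if \<tau> = 1 then B else R" and ?K = "complete_bipartite_edges X Y"
  let ?D = "sym_diff ?E ?K"
  have K: "{x, y} \<in> ?K \<longleftrightarrow> f x * f y = -1" if "x \<in> V" "y \<in> V" for x y
    using f[of x] f[of y] that unfolding XY complete_bipartite_edges_def by (auto simp: doubleton_eq_iff)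
  have "?K \<subseteq> nsets V 2"
    unfolding XY complete_bipartite_edges_def nsets_2_eq by fastforce
  then have "?D \<subseteq> nsets V 2" using edges by auto
  then have "4 * real (card ?D) \<le> 2 * (\<Sum>x\<in>V. \<Sum>y\<in>V. of_bool ({x, y} \<in> ?D))"
    using card_edges_le_sum_pairs[OF finite_V, of ?D] by linarith
  also have "\<dots> = (\<Sum>x\<in>V. \<Sum>y\<in>V. 2 * of_bool ({x, y} \<in> ?D))" by (simp only: sum_distrib_left)
  also have "\<dots> \<le> (\<Sum>x\<in>V. \<Sum>y\<in>V. 1 - \<tau> * (sign x y * (f x * f y)))"
  proof (intro sum_mono)
    fix x y assume xy: "x \<in> V" "y \<in> V"
    have nn: "0 \<le> 1 - \<tau> * (sign x y * (f x * f y))"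
      using \<tau> f[of x] f[of y] abs_sign_le[of x y] by (auto simp: abs_le_iff)
    show "2 * of_bool ({x, y} \<in> ?D) \<le> 1 - \<tau> * (sign x y * (f x * f y))"
    proof (cases "{x, y} \<in> ?D")
      case True
      then have "x \<noteq> y" using \<open>?D \<subseteq> nsets V 2\<close> by (auto simp: nsets_def)
      then have s: "{x, y} \<in> R \<and> {x, y} \<notin> B \<and> sign x y = 1 \<or> {x, y} \<notin> R \<and> {x, y} \<in> B \<and> sign x y = -1"
        using edge_iff[OF xy] disjoint by (auto simp: sign_def red_def blue_def)
      have ff: "f x * f y = 1 \<or> f x * f y = -1" using f[of x] f[of y] by auto
      have "\<tau> * (sign x y * (f x * f y)) = -1"
        using True K[OF xy] s ff \<tau> by (auto split: if_splits)
      then show ?thesis using True by simp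
    next
      case False
      then have "of_bool ({x, y} \<in> ?D) = (0 :: real)" by (simp only: of_bool_eq)
      then show ?thesis using nn by linarith
    qed
  qed
  also have "\<dots> = n\<^sup>2 - \<tau> * (\<Sum>x\<in>V. \<Sum>y\<in>V. sign x y * (f x * f y))"
    by (simp add: sum_subtractf n_def power2_eq_square sum_distrib_left)
  also have "\<dots> \<le> \<eta> * n\<^sup>2" using sum by (simp add: algebra_simps)
  finally show ?thesis .
qed

text \<open>Since \<open>f x * f y\<close> is close to \<open>\<tau> * sign x y\<close>, its total
  is close to the total imbalance up to sign, which balanced degrees keep small.\<close>

lemma sum_signs_sq_le:
  assumes f: "\<And>x. f x = 1 \<or> f x = (-1::real)" and \<tau>: "\<tau> = 1 \<or> \<tau> = (-1::real)"
    and sum: "(1 - \<eta>) * n\<^sup>2 \<le> \<tau> * (\<Sum>x\<in>V. \<Sum>y\<in>V. sign x y * (f x * f y))"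
  shows "(\<Sum>x\<in>V. f x)\<^sup>2 \<le> \<eta> * n\<^sup>2 + (\<Sum>x\<in>V. \<bar>imbalance x\<bar>)"
proof -
  have "(\<Sum>x\<in>V. f x)\<^sup>2 = (\<Sum>x\<in>V. \<Sum>y\<in>V. f x * f y)" by (simp add: power2_eq_square sum_product)
  \<comment> \<open>Termwise this says that (1 - f x * f y) * (1 + \<tau> * sign x y) is
    nonnegative.\<close>
  also have "\<dots> \<le> (\<Sum>x\<in>V. \<Sum>y\<in>V. 1 - \<tau> * (sign x y * (f x * f y)) + \<tau> * sign x y)"
  proof (intro sum_mono)
    fix x y
    show "f x * f y \<le> 1 - \<tau> * (sign x y * (f x * f y)) + \<tau> * sign x y"
      using \<tau> f[of x] f[of y] abs_sign_le[of x y] by (auto simp: abs_le_iff)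
  qed
  also have "\<dots> = n\<^sup>2 - \<tau> * (\<Sum>x\<in>V. \<Sum>y\<in>V. sign x y * (f x * f y)) + (\<Sum>x\<in>V. \<tau> * imbalance x)"
    by (simp add: sum_subtractf sum.distrib n_def power2_eq_square sum_distrib_left imbalance_def)
  also have "\<dots> \<le> \<eta> * n\<^sup>2 + (\<Sum>x\<in>V. \<bar>imbalance x\<bar>)"
  proof (intro add_mono sum_mono)
    show "\<tau> * imbalance x \<le> \<bar>imbalance x\<bar>" for x using \<tau> by auto
  qed (use sum in \<open>simp add: algebra_simps\<close>)
  finally show ?thesis .
qed

lemma delta_bipartite_if_many_alternating_cycles:
  assumes t: "t \<ge> 2" and \<epsilon>: "0 < \<epsilon>" "\<epsilon> \<le> 1 / 2 ^ 34" and n: "n \<ge> 2" "4 / \<epsilon> \<le> n"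
    and many: "real (card (alternating_cycles V R B (4 * t)))
       > (1 - \<epsilon>) * (n / real (4 * t)) * ((n - 1) / 2) ^ (4 * t - 1)"
  shows "delta_bipartite ((4 * \<epsilon>) powr (1 / 32)) V R B"
proof -
  define \<delta> where "\<delta> = (4 * \<epsilon>) powr (1 / 32)"
  have \<delta>0: "\<delta> > 0" using \<epsilon> by (simp add: \<delta>_def)
  have "\<delta> ^ 32 = 4 * \<epsilon>" using \<epsilon> by (simp add: \<delta>_def powr_power)
  \<comment> \<open>The bound 2^-34 on \<epsilon> is chosen so that \<delta> is at most 1/2.\<close>
  then have "\<delta> ^ 32 \<le> (1 / 2) ^ 32" using \<epsilon> by (simp add: power_divide)
  then have \<delta>2: "\<delta> \<le> 1 / 2" by (rule power_le_imp_le_base[of _ 31, simplified]) simp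
  have "\<epsilon> = (\<delta> ^ 16 / 2)\<^sup>2" using \<open>\<delta> ^ 32 = 4 * \<epsilon>\<close> by (simp add: power_divide flip: power_mult)
  then have sqrt: "sqrt \<epsilon> = \<delta> ^ 16 / 2" using \<delta>0 by simp
  \<comment> \<open>All losses are multiples of the root of \<epsilon>, that is of \<delta>^16.
    Fourteen of these factors absorb the constant 75, and the remaining \<delta>^2 allows for the
    square root taken when the part sizes are compared.\<close>
  have "\<delta> ^ 14 \<le> (1 / 2) ^ 14" using \<delta>0 \<delta>2 by (intro power_mono) auto
  then have "75 * \<delta> ^ 14 \<le> 1" by (simp add: power_divide)
  then have "75 * \<delta> ^ 14 * \<delta>\<^sup>2 \<le> 1 * \<delta>\<^sup>2" by (intro mult_right_mono) auto
  then have small: "150 * sqrt \<epsilon> \<le> \<delta>\<^sup>2" by (simp add: sqrt mult.assoc flip: power_add)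
  have \<delta>sq: "\<delta>\<^sup>2 \<le> \<delta> / 2" using mult_left_mono[OF \<delta>2, of \<delta>] \<delta>0 by (simp add: power2_eq_square)
  have n1: "n > 1" using n by simp
  have W: "walk_norm 1 \<ge> (1 - 2 * \<epsilon>) * n * ((n - 1) / 2) ^ 4" by (rule walk_norm_1_ge[OF t n1 many])
  have "(\<Sum>x\<in>V. (imbalance x)\<^sup>2) \<le> 2 * \<epsilon> * n ^ 3" using sum_imbalance_sq_le[OF n1 _ W] \<epsilon> by simp
  then have imb: "(\<Sum>x\<in>V. \<bar>imbalance x\<bar>) \<le> 2 * sqrt \<epsilon> * n\<^sup>2" using sum_abs_imbalance_le[OF n1] \<epsilon> by simp
  have "(1 - 50 * sqrt \<epsilon>) * n ^ 4 \<le> (\<Sum>u\<in>V. \<Sum>v\<in>V. (correlation u v)\<^sup>2)"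
    by (rule sum_correlation_sq_ge[OF _ _ n1 n(2) W]) (use \<epsilon> in auto)
  moreover have "V \<noteq> {}" using n by (auto simp: n_def)
  moreover have "50 * sqrt \<epsilon> \<le> 1 / 2" using small \<delta>sq \<delta>2 by linarith
  moreover have "0 \<le> 50 * sqrt \<epsilon>" using \<epsilon> by simp
  ultimately obtain f \<tau> where f: "\<And>x. f x = 1 \<or> f x = (-1::real)" and \<tau>: "\<tau> = 1 \<or> \<tau> = (-1::real)"
    and sum: "(1 - 3 * (50 * sqrt \<epsilon>)) * n\<^sup>2 \<le> \<tau> * (\<Sum>x\<in>V. \<Sum>y\<in>V. sign x y * (f x * f y))"
    unfolding correlation_def n_def
    using symmetric_sign_factorisation[of V sign "50 * sqrt \<epsilon>", OF finite_V _ sign_sym abs_sign_le] by blast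
  have sum': "(1 - \<delta>\<^sup>2) * n\<^sup>2 \<le> \<tau> * (\<Sum>x\<in>V. \<Sum>y\<in>V. sign x y * (f x * f y))"
  proof -
    have "(1 - \<delta>\<^sup>2) * n\<^sup>2 \<le> (1 - 3 * (50 * sqrt \<epsilon>)) * n\<^sup>2" using small by (intro mult_right_mono) auto
    then show ?thesis using sum by linarith
  qed
  define X Y where XY: "X = {x \<in> V. f x = 1}" "Y = {x \<in> V. f x = -1}"
  have part: "X \<union> Y = V" "X \<inter> Y = {}" using f by (auto simp: XY)
  have finXY: "finite X" "finite Y" using finite_V by (auto simp: XY)
  have cards: "real (card X) + real (card Y) = n"
    using card_Un_disjoint[OF finXY part(2)] by (simp add: n_def part(1))
  have "(\<Sum>x\<in>V. f x) = (\<Sum>x\<in>X. f x) + (\<Sum>x\<in>Y. f x)"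
    unfolding part(1)[symmetric] by (rule sum.union_disjoint[OF finXY part(2)])
  also have "\<dots> = real (card X) - real (card Y)" by (simp add: XY)
  finally have diff: "(\<Sum>x\<in>V. f x) = real (card X) - real (card Y)" .
  \<comment> \<open>The deviation of either part from n / 2 is half the difference of the sizes, so
    a difference of at most 2\<delta>n suffices.\<close>
  have "(real (card X) - real (card Y))\<^sup>2 \<le> \<delta>\<^sup>2 * n\<^sup>2 + (\<Sum>x\<in>V. \<bar>imbalance x\<bar>)"
    using sum_signs_sq_le[OF f \<tau> sum'] by (simp add: diff)
  also have "\<dots> \<le> \<delta>\<^sup>2 * n\<^sup>2 + 2 * sqrt \<epsilon> * n\<^sup>2" using imb by simp
  also have "\<dots> \<le> 4 * \<delta>\<^sup>2 * n\<^sup>2"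
  proof -
    have "2 * sqrt \<epsilon> * n\<^sup>2 \<le> 3 * \<delta>\<^sup>2 * n\<^sup>2" using small real_sqrt_gt_zero[OF \<epsilon>(1)] by (intro mult_right_mono) (linarith, simp)
    then show ?thesis by simp
  qed
  also have "\<dots> = (2 * \<delta> * n)\<^sup>2" by (simp add: power_mult_distrib)
  finally have "\<bar>real (card X) - real (card Y)\<bar>\<^sup>2 \<le> (2 * \<delta> * n)\<^sup>2" by simp
  then have balanced: "\<bar>real (card X) - real (card Y)\<bar> \<le> 2 * \<delta> * n"
    by (rule power2_le_imp_le) (use \<delta>0 n in simp)
  have fl: "real_of_int \<lfloor>real (card V) / 2\<rfloor> \<le> n / 2" "n / 2 \<le> real_of_int \<lceil>real (card V) / 2\<rceil>"
    unfolding n_def by (rule of_int_floor_le le_of_int_ceiling)+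
  have b1: "real_of_int \<lfloor>real (card V) / 2\<rfloor> - \<delta> * real (card V) \<le> real (card Z) \<and>
      real (card Z) \<le> real_of_int \<lceil>real (card V) / 2\<rceil> + \<delta> * real (card V)" if "Z \<in> {X, Y}" for Z
  proof -
    have "n / 2 - \<delta> * n \<le> real (card Z) \<and> real (card Z) \<le> n / 2 + \<delta> * n"
      using that balanced cards by (auto simp: abs_le_iff)
    then show ?thesis using fl unfolding n_def by linarith
  qed
  have "4 * real (card (sym_diff (if \<tau> = 1 then B else R) (complete_bipartite_edges X Y))) \<le> \<delta>\<^sup>2 * n\<^sup>2"
    by (rule card_sym_diff_bipartite_le[OF f \<tau> XY sum'])
  also have "\<dots> \<le> \<delta> * n\<^sup>2" using \<delta>sq \<delta>0 by (intro mult_right_mono) auto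
  \<comment> \<open>For n at least 2, n^2 is at most 2n(n - 1), which is four times the number of
    edges.\<close>
  also have "\<dots> \<le> 4 * (\<delta> * real (card V choose 2))"
  proof -
    have "even (card V * (card V - 1))" by (cases "card V") auto
    then have "2 * (card V choose 2) = card V * (card V - 1)" by (simp only: choose_two dvd_mult_div_cancel)
    then have "2 * real (card V choose 2) = real (card V * (card V - 1))" by (metis of_nat_mult of_nat_numeral)
    then have "2 * real (card V choose 2) = n * (n - 1)"
      using n unfolding n_def by (simp add: of_nat_diff)
    moreover have "n * 2 \<le> n * n" using n by (intro mult_left_mono) auto
    ultimately have "n\<^sup>2 \<le> 4 * real (card V choose 2)" by (simp add: power2_eq_square algebra_simps)
    then have "\<delta> * n\<^sup>2 \<le> \<delta> * (4 * real (card V choose 2))" using \<delta>0 by (intro mult_left_mono) auto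
    then show ?thesis by simp
  qed
  finally have "real (card (sym_diff (if \<tau> = 1 then B else R) (complete_bipartite_edges X Y)))
      \<le> \<delta> * real (card V choose 2)" by simp
  then have "real (card (sym_diff R (complete_bipartite_edges X Y))) \<le> \<delta> * real (card V choose 2) \<or>
      real (card (sym_diff B (complete_bipartite_edges X Y))) \<le> \<delta> * real (card V choose 2)"
    by (simp split: if_splits)
  then show ?thesis
    unfolding delta_bipartite_def \<delta>_def[symmetric] using part b1 by blast
qed

end

theorem theorem6p1:
  fixes t :: nat
  assumes "t \<ge> 2"
  shows "\<exists>\<epsilon>\<^sub>0::real. \<epsilon>\<^sub>0 > 0 \<and> (\<forall>\<epsilon>::real. 0 < \<epsilon> \<and> \<epsilon> \<le> \<epsilon>\<^sub>0 \<longrightarrow>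
           (\<exists>n\<^sub>0::nat. \<forall>n\<ge>n\<^sub>0. \<forall>(V::'a set) R B.
              red_blue_complete V R B \<and> card V = n \<and>
              real (card (alternating_cycles V R B (4 * t)))
                > (1 - \<epsilon>) * (real n / real (4 * t)) * ((real n - 1) / 2) ^ (4 * t - 1)
              \<longrightarrow> delta_bipartite ((4 * \<epsilon>) powr (1 / 32)) V R B))"
proof (intro exI[of _ "1 / 2 ^ 34 :: real"] conjI allI impI)
  fix \<epsilon> :: real assume \<epsilon>: "0 < \<epsilon> \<and> \<epsilon> \<le> 1 / 2 ^ 34"
  show "\<exists>n\<^sub>0::nat. \<forall>n\<ge>n\<^sub>0. \<forall>(V::'a set) R B.
              red_blue_complete V R B \<and> card V = n \<and>
              real (card (alternating_cycles V R B (4 * t)))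
                > (1 - \<epsilon>) * (real n / real (4 * t)) * ((real n - 1) / 2) ^ (4 * t - 1)
              \<longrightarrow> delta_bipartite ((4 * \<epsilon>) powr (1 / 32)) V R B"
  \<comment> \<open>The 2 serves the comparison of n^2 with the number of edges, and 4 / \<epsilon>
    the use of Bernoulli's inequality.\<close>
  proof (intro exI[of _ "max 2 (nat \<lceil>4 / \<epsilon>\<rceil>)"] allI impI, elim conjE)
    fix n :: nat and V :: "'a set" and R B
    assume n: "max 2 (nat \<lceil>4 / \<epsilon>\<rceil>) \<le> n" and rb: "red_blue_complete V R B" and card: "card V = n"
      and many: "real (card (alternating_cycles V R B (4 * t)))
                > (1 - \<epsilon>) * (real n / real (4 * t)) * ((real n - 1) / 2) ^ (4 * t - 1)"
    interpret red_blue_colouring V R B by unfold_locales (rule rb)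
    have "4 / \<epsilon> \<le> real n" using n by linarith
    then show "delta_bipartite ((4 * \<epsilon>) powr (1 / 32)) V R B"
      using delta_bipartite_if_many_alternating_cycles[OF assms, of \<epsilon>] \<epsilon> n many
      unfolding n_def card by simp
  qed
qed simp

end
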